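(* Every ($P_5$, $C_5$, house, co-banner)-free graph $G$ on $n$ vertices is recolorable, and the diameter of $R_\ell(G)$ is at most $2n^2$ for all $\ell\ge\chi(G)+1$.
   Context: All graphs are finite and simple. A $k$-coloring of $G$ is a map $V(G)\to\{1,\dots,k\}$ giving adjacent vertices different values; $\chi(G)$ is the chromatic number. $R_k(G)$ denotes the graph whose vertices are the $k$-colorings of $G$, two being adjacent if they differ in color on exactly one vertex. $G$ is recolorable if $R_\ell(G)$ is connected for all $\ell\ge\chi(G)+1$. A graph is $(H_1,\dots,H_r)$-free if it has no induced subgraph isomorphic to any $H_i$. $P_5$ and $C_5$ are the path and cycle on 5 vertices. The house is the complement of $P_5$ (a 4-cycle plus a fifth vertex adjacent to exactly two consecutive vertices of the cycle). The co-banner is the graph on vertices $a,b,c,d,e$ with edge set $\{ab, ac, bc, cd, de\}$. *)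

theory Defs
  imports "Graph_Theory.Graph_Theory" "HOL-Library.FuncSet"
begin

definition colorings :: "'a pair_pre_digraph \<Rightarrow> nat \<Rightarrow> ('a \<Rightarrow> nat) set" where
  "colorings G k =
     {c \<in> pverts G \<rightarrow>\<^sub>E {1..k}. \<forall>(u, v) \<in> parcs G. c u \<noteq> c v}"

definition chromatic_number :: "'a pair_pre_digraph \<Rightarrow> nat" where
  "chromatic_number G = (LEAST k. colorings G k \<noteq> {})"

definition recoloring_graph :: "'a pair_pre_digraph \<Rightarrow> nat \<Rightarrow> ('a \<Rightarrow> nat) pair_pre_digraph" where
  "recoloring_graph G k =
     \<lparr> pverts = colorings G k,
       parcs = {(c, d). c \<in> colorings G k \<and> d \<in> colorings G k \<and>
                        (\<exists>!v. v \<in> pverts G \<and> c v \<noteq> d v)} \<rparr>"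

definition recolorable :: "'a pair_pre_digraph \<Rightarrow> bool" where
  "recolorable G \<longleftrightarrow>
     (\<forall>l \<ge> chromatic_number G + 1. Digraph_Component.connected (with_proj (recoloring_graph G l)))"

text \<open>
  With unit arc costs, \<mu> is the length of a shortest walk, and is infinite if there is
  no walk.
\<close>

definition diameter :: "'a pair_pre_digraph \<Rightarrow> ereal" where
  "diameter G =
     (SUP u \<in> pverts G. SUP v \<in> pverts G. wf_digraph.\<mu> (with_proj G) (\<lambda>_. 1) u v)"

definition induced_free :: "'b pair_pre_digraph set \<Rightarrow> 'a pair_pre_digraph \<Rightarrow> bool" where
  "induced_free \<H> G \<longleftrightarrow>
     (\<forall>H \<in> \<H>. \<not> (\<exists>K. induced_subgraph K (with_proj G) \<and> digraph_iso (with_proj H) K))"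

definition edge_graph :: "nat \<Rightarrow> nat rel \<Rightarrow> nat pair_pre_digraph" where
  "edge_graph n E = \<lparr> pverts = {..<n}, parcs = E \<union> E\<inverse> \<rparr>"

definition complement_graph :: "'a pair_pre_digraph \<Rightarrow> 'a pair_pre_digraph" where
  "complement_graph G =
     \<lparr> pverts = pverts G,
       parcs = {(u, v). u \<in> pverts G \<and> v \<in> pverts G \<and> u \<noteq> v \<and> (u, v) \<notin> parcs G} \<rparr>"

definition P5 :: "nat pair_pre_digraph" where
  "P5 = edge_graph 5 {(0, 1), (1, 2), (2, 3), (3, 4)}"

definition C5 :: "nat pair_pre_digraph" where
  "C5 = edge_graph 5 {(0, 1), (1, 2), (2, 3), (3, 4), (4, 0)}"

definition house :: "nat pair_pre_digraph" where
  "house = complement_graph P5"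

definition co_banner :: "nat pair_pre_digraph" where
  "co_banner = edge_graph 5 {(0, 1), (0, 2), (1, 2), (2, 3), (3, 4)}"

lemma pair_graph_edge_graph:
  assumes "E \<subseteq> {..<n} \<times> {..<n}" and "irrefl E"
  shows "pair_graph (edge_graph n E)"
proof -
  have "finite E"
    using assms(1) finite_subset by blast
  then show ?thesis
    using assms
    by unfold_locales
      (auto simp: edge_graph_def symmetric_def arcs_ends_conv sym_def irrefl_def)
qed

lemma pair_graph_complement_graph:
  assumes "pair_graph G"
  shows "pair_graph (complement_graph G)"
proof -
  interpret pair_graph G by fact
  have "parcs (complement_graph G) \<subseteq> pverts G \<times> pverts G"
    by (auto simp: complement_graph_def)
  then have "finite (parcs (complement_graph G))"
    using pair_finite_verts finite_subset by blast
  moreover have "(v, u) \<in> parcs G" if "(u, v) \<in> parcs G" for u v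
    using that pair_sym_arcs by (auto simp: symmetric_def sym_def)
  ultimately show ?thesis
    using pair_finite_verts
    by unfold_locales
      (auto simp: complement_graph_def symmetric_def arcs_ends_conv sym_def)
qed

lemma pair_graph_P5: "pair_graph P5"
  and pair_graph_C5: "pair_graph C5"
  and pair_graph_co_banner: "pair_graph co_banner"
  unfolding P5_def C5_def co_banner_def
  by (rule pair_graph_edge_graph; auto simp: irrefl_def)+

lemma pair_graph_house: "pair_graph house"
  unfolding house_def by (intro pair_graph_complement_graph pair_graph_P5)

lemma induced_free_iff_no_embedding:
  assumes G: "pair_graph G" and \<H>: "\<And>H. H \<in> \<H> \<Longrightarrow> pair_graph H"
  shows "induced_free \<H> G \<longleftrightarrow>
    (\<forall>H \<in> \<H>. \<not> (\<exists>f. inj_on f (pverts H) \<and> f ` pverts H \<subseteq> pverts G \<and>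
       (\<forall>u \<in> pverts H. \<forall>v \<in> pverts H. (f u, f v) \<in> parcs G \<longleftrightarrow> (u, v) \<in> parcs H)))"
proof -
  interpret G: pair_graph G by fact
  have "(\<exists>K. induced_subgraph K (with_proj G) \<and> digraph_iso (with_proj H) K) \<longleftrightarrow>
    (\<exists>f. inj_on f (pverts H) \<and> f ` pverts H \<subseteq> pverts G \<and>
      (\<forall>u \<in> pverts H. \<forall>v \<in> pverts H. (f u, f v) \<in> parcs G \<longleftrightarrow> (u, v) \<in> parcs H))"
    (is "?L \<longleftrightarrow> ?R") if "H \<in> \<H>" for H
  proof -
    interpret H: pair_graph H by (rule \<H>[OF that])
    show ?thesis
    proof
      assume ?L
      then obtain h where ind: "induced_subgraph (app_iso h (with_proj H)) (with_proj G)"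
        and h: "pre_digraph.digraph_isomorphism (with_proj H) h"
        by (auto simp: digraph_iso_def)
      define f where "f = iso_verts h"
      have proj: "iso_tail h = fst" "iso_head h = snd"
        using ind by (auto simp: induced_subgraph_def subgraph_def compatible_def)
      have inj: "inj_on f (pverts H)"
        using h by (auto simp: pre_digraph.digraph_isomorphism_def f_def)
      have arc: "iso_arcs h (u, v) = (f u, f v)" if "(u, v) \<in> parcs H" for u v
        using h that proj
        by (auto simp: pre_digraph.digraph_isomorphism_def f_def prod_eq_iff)
      have sub: "f ` pverts H \<subseteq> pverts G"
        using ind by (auto simp: induced_subgraph_def subgraph_def f_def)
      have arcs: "iso_arcs h ` parcs H =
          {e \<in> parcs G. fst e \<in> f ` pverts H \<and> snd e \<in> f ` pverts H}"
        using ind by (auto simp: induced_subgraph_def f_def)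
      have "(f u, f v) \<in> parcs G \<longleftrightarrow> (u, v) \<in> parcs H"
        if uv: "u \<in> pverts H" "v \<in> pverts H" for u v
      proof
        assume "(f u, f v) \<in> parcs G"
        then have "(f u, f v) \<in> iso_arcs h ` parcs H"
          using uv arcs by auto
        then obtain x y where xy: "(x, y) \<in> parcs H" "(f u, f v) = iso_arcs h (x, y)"
          by auto
        then have "f x = f u" "f y = f v" using arc by auto
        moreover have "x \<in> pverts H" "y \<in> pverts H"
          using xy(1) H.in_arcsD1 H.in_arcsD2 by auto
        ultimately show "(u, v) \<in> parcs H"
          using inj uv xy(1) by (metis inj_onD)
      next
        assume uvH: "(u, v) \<in> parcs H"
        then have "iso_arcs h (u, v) \<in> iso_arcs h ` parcs H" by blast
        then show "(f u, f v) \<in> parcs G"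
          unfolding arcs arc[OF uvH] by simp
      qed
      then show ?R using inj sub by blast
    next
      assume ?R
      then obtain f where inj: "inj_on f (pverts H)" and sub: "f ` pverts H \<subseteq> pverts G"
        and adj: "\<And>u v. u \<in> pverts H \<Longrightarrow> v \<in> pverts H \<Longrightarrow>
          (f u, f v) \<in> parcs G \<longleftrightarrow> (u, v) \<in> parcs H"
        by blast
      define h where "h = \<lparr>iso_verts = f, iso_arcs = map_prod f f,
        iso_head = snd :: _ \<times> _ \<Rightarrow> _, iso_tail = fst\<rparr>"
      have Hs: "parcs H \<subseteq> pverts H \<times> pverts H"
        using H.in_arcsD1 H.in_arcsD2 by auto
      have injp: "inj_on (map_prod f f) (parcs H)"
        using inj_on_subset[OF map_prod_inj_on[OF inj inj] Hs] .
      have h: "pre_digraph.digraph_isomorphism (with_proj H) h"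
        using inj injp H.wf_digraph
        by (auto simp: pre_digraph.digraph_isomorphism_def h_def)
      let ?K = "app_iso h (with_proj H)"
      have wfK: "wf_digraph ?K"
        using h by (rule H.wf_digraphI_app_iso)
      have arcs: "arcs ?K = {e \<in> parcs G. fst e \<in> f ` pverts H \<and> snd e \<in> f ` pverts H}"
      proof (intro set_eqI iffI)
        fix e assume "e \<in> arcs ?K"
        then obtain u v where "(u, v) \<in> parcs H" "e = (f u, f v)"
          by (auto simp: h_def)
        then show "e \<in> {e \<in> parcs G. fst e \<in> f ` pverts H \<and> snd e \<in> f ` pverts H}"
          using adj Hs by auto
      next
        fix e assume "e \<in> {e \<in> parcs G. fst e \<in> f ` pverts H \<and> snd e \<in> f ` pverts H}"
        then obtain u v where "u \<in> pverts H" "v \<in> pverts H" "e = (f u, f v)" "e \<in> parcs G"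
          by (cases e) auto
        then show "e \<in> arcs ?K"
          using adj by (force simp: h_def)
      qed
      have "induced_subgraph ?K (with_proj G)"
        using arcs wfK G.wf_digraph sub
        by (auto simp: induced_subgraph_def subgraph_def compatible_def h_def)
      then show ?L using h by (auto simp: digraph_iso_def)
    qed
  qed
  then show ?thesis by (auto simp: induced_free_def)
qed

text \<open>The 4-cycle 0-3-1-4 with 2 attached to the consecutive vertices 4 and 0:\<close>

lemma house_eq_edge_graph:
  "house = edge_graph 5 {(0, 3), (3, 1), (1, 4), (4, 0), (2, 0), (2, 4)}"
proof -
  define E :: "nat rel" where "E = {(0, 3), (3, 1), (1, 4), (4, 0), (2, 0), (2, 4)}"
  have adj: "(u \<noteq> v \<and> (u, v) \<notin> parcs P5) \<longleftrightarrow> (u, v) \<in> E \<or> (v, u) \<in> E"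
    if "u < 5" "v < 5" for u v
  proof -
    have "u = 0 \<or> u = 1 \<or> u = 2 \<or> u = 3 \<or> u = 4" "v = 0 \<or> v = 1 \<or> v = 2 \<or> v = 3 \<or> v = 4"
      using that by linarith+
    then show ?thesis
      by (elim disjE; hypsubst; simp add: P5_def edge_graph_def E_def)
  qed
  have bound: "u < 5 \<and> v < 5" if "(u, v) \<in> E" for u v
    using that by (auto simp: E_def)
  have P: "pverts P5 = {..<5}"
    by (simp add: P5_def edge_graph_def)
  have "parcs house = E \<union> E\<inverse>"
    unfolding house_def complement_graph_def using adj bound by (auto simp: P)
  then have "house = edge_graph 5 E"
    by (simp add: house_def complement_graph_def edge_graph_def P)
  then show ?thesis by (simp only: E_def)
qed

lemma pair_graph_recoloring_graph:
  assumes "pair_graph G"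
  shows "pair_graph (recoloring_graph G k)"
proof -
  interpret pair_graph G by fact
  have fin: "finite (colorings G k)"
    by (rule finite_subset[of _ "pverts G \<rightarrow>\<^sub>E {1..k}"])
      (auto simp: colorings_def intro: finite_PiE)
  have "parcs (recoloring_graph G k) \<subseteq> colorings G k \<times> colorings G k"
    by (auto simp: recoloring_graph_def)
  then have fin': "finite (parcs (recoloring_graph G k))"
    using fin finite_subset by blast
  have "sym (parcs (recoloring_graph G k))"
    by (rule symI) (auto simp: recoloring_graph_def eq_commute)
  then show ?thesis
    using fin fin'
    by unfold_locales
      (auto simp: recoloring_graph_def symmetric_def arcs_ends_conv)
qed

end

theory Submission
  imports Defs
begin

text \<open>
  Every graph of the class with at least two vertices is a join, a disjoint union, or contains
  comparable vertices \<open>s \<noteq> w\<close>, that is, with \<open>N(w) \<subseteq> N(s)\<close>. If \<open>2K2\<close> is absent, the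
  complement is free of \<open>C4\<close>, \<open>C5\<close> and \<open>P5\<close>, and comparable vertices exist unless the graph is
  complete. If \<open>2K2\<close> is present, choose anticomplete sets \<open>A\<close>, \<open>B\<close> without isolated vertices and
  with \<open>A \<union> B\<close> as large as possible: every other vertex is complete or anticomplete to \<open>A \<union> B\<close>,
  and an anticomplete one is dominated by the vertices of \<open>A\<close>.

  By induction along this decomposition there is one partition into \<open>\<chi>\<close> color classes such that
  every coloring with a spare color reaches a coloring with these classes while recoloring
  each vertex at most \<open>n - 1\<close> times. Permuting the colors of the classes costs two more
  recolorings per vertex, so any two colorings are joined by \<open>2(n - 1) + 2 = 2n\<close> recolorings
  per vertex.
\<close>

section \<open>Recoloring sequences\<close>

text \<open>The palette \<open>X\<close> is an arbitrary set, so that the two sides of a join can be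
  recolored within disjoint palettes. Values outside \<open>V\<close> are unconstrained, so a
  coloring passes to induced subgraphs unchanged.\<close>

definition proper :: "('v \<Rightarrow> 'v \<Rightarrow> bool) \<Rightarrow> 'v set \<Rightarrow> nat set \<Rightarrow> ('v \<Rightarrow> nat) \<Rightarrow> bool" where
  "proper E V X c \<longleftrightarrow> c ` V \<subseteq> X \<and> (\<forall>u \<in> V. \<forall>v \<in> V. E u v \<longrightarrow> c u \<noteq> c v)"

text \<open>
  \<open>m v\<close> counts how often \<open>v\<close> is recolored; a step may leave the color unchanged.
\<close>

inductive recol :: "('v \<Rightarrow> 'v \<Rightarrow> bool) \<Rightarrow> 'v set \<Rightarrow> nat set \<Rightarrow>
    ('v \<Rightarrow> nat) \<Rightarrow> ('v \<Rightarrow> nat) \<Rightarrow> ('v \<Rightarrow> nat) \<Rightarrow> bool"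
  for E V X c where
  refl: "proper E V X c \<Longrightarrow> recol E V X c (\<lambda>_. 0) c"
| step: "recol E V X c m d \<Longrightarrow> v \<in> V \<Longrightarrow> proper E V X (d(v := x)) \<Longrightarrow>
    recol E V X c (m(v := Suc (m v))) (d(v := x))"

lemma recol_properD:
  assumes "recol E V X c m d"
  shows "proper E V X c" "proper E V X d"
  using assms by (induction) auto

lemma recol_outside: "recol E V X c m d \<Longrightarrow> v \<notin> V \<Longrightarrow> m v = 0 \<and> d v = c v"
  by (induction rule: recol.induct) auto

lemma recol_trans:
  assumes "recol E V X d m' e" "recol E V X c m d"
  shows "recol E V X c (\<lambda>v. m v + m' v) e"
  using assms
proof (induction rule: recol.induct)
  case refl
  then show ?case by simp
next
  case (step m' d' v x)
  have "(\<lambda>u. m u + (m'(v := Suc (m' v))) u) = (\<lambda>u. m u + m' u)(v := Suc (m v + m' v))"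
    by auto
  then show ?case
    using recol.step[OF step.IH[OF step.prems] step.hyps(2,3)] by (simp del: fun_upd_apply)
qed

text \<open>Undoing a step recolors the same vertex, so the counts survive reversal.\<close>

lemma recol_sym:
  assumes "recol E V X c m d"
  shows "recol E V X d m c"
  using assms
proof (induction rule: recol.induct)
  case refl
  then show ?case by (rule recol.refl)
next
  case (step m d v x)
  have "recol E V X (d(v := x)) ((\<lambda>_. 0)(v := Suc 0)) ((d(v := x))(v := d v))"
    using recol.step[OF recol.refl[OF step.hyps(3)] step.hyps(2), of "d v"]
      recol_properD(2)[OF step.hyps(1)] by simp
  then have "recol E V X (d(v := x)) ((\<lambda>_. 0)(v := Suc 0)) d" by simp
  from recol_trans[OF step.IH this]
  have "recol E V X (d(v := x)) (\<lambda>u. ((\<lambda>_. 0)(v := Suc 0)) u + m u) c" .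
  moreover have "(\<lambda>u. ((\<lambda>_. 0)(v := Suc 0)) u + m u) = m(v := Suc (m v))" by auto
  ultimately show ?case by (simp del: fun_upd_apply)
qed

text \<open>Vertices outside \<open>W\<close> keep their colors and recolored vertices receive
  colors from \<open>Y\<close>, so a conflict across the boundary would need an outer neighbor
  colored from \<open>Y\<close>. In a disjoint union there are no outer neighbors; in a join their
  colors lie outside \<open>Y\<close>.\<close>

lemma recol_mono:
  assumes "recol E W Y c m d" "W \<subseteq> V" "Y \<subseteq> X" "symp E" "proper E V X c"
    and "\<And>u v. u \<in> V - W \<Longrightarrow> v \<in> W \<Longrightarrow> E u v \<Longrightarrow> c u \<notin> Y"
  shows "recol E V X c m d"
  using assms(1)
proof (induction rule: recol.induct)
  case refl
  show ?case using assms(5) by (rule recol.refl)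
next
  case (step m d v x)
  have pd: "proper E V X d" using recol_properD(2)[OF step.IH] .
  have pW: "proper E W Y (d(v := x))" by (rule step.hyps)
  have out: "d u = c u" if "u \<notin> W" for u
    using recol_outside[OF step.hyps(1) that] by simp
  have x: "x \<in> Y" using pW step.hyps(2) by (auto simp: proper_def)
  have "proper E V X (d(v := x))"
    unfolding proper_def
  proof (intro conjI ballI impI)
    show "(d(v := x)) ` V \<subseteq> X"
      using pd x assms(3) by (auto simp: proper_def)
    have key: "d w \<noteq> x" if "w \<in> V" "w \<noteq> v" "E w v" for w
    proof (cases "w \<in> W")
      case True
      then show ?thesis using pW step.hyps(2) that by (force simp: proper_def)
    next
      case False
      then show ?thesis using assms(6)[of w v] that out[of w] x step.hyps(2) by auto
    qed
    fix u w assume uw: "u \<in> V" "w \<in> V" "E u w"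
    have ne: "u \<noteq> w"
      using pd uw by (auto simp: proper_def)
    show "(d(v := x)) u \<noteq> (d(v := x)) w"
    proof (cases "u = v \<or> w = v")
      case True
      then show ?thesis using key[of u] key[of w] uw ne sympD[OF assms(4) uw(3)] by auto
    next
      case False
      then show ?thesis using pd uw by (auto simp: proper_def)
    qed
  qed
  moreover have "v \<in> V" using step.hyps(2) assms(2) by blast
  ultimately show ?case by (intro recol.step[OF step.IH])
qed

text \<open>Properness of the final coloring makes \<open>W\<close> independent and keeps
  \<open>x\<close> off its neighbors, so the vertices of \<open>W\<close> can move to
  \<open>x\<close> one at a time.\<close>

lemma recol_independent:
  assumes "finite W" "W \<subseteq> V" "proper E V X d"
    and p: "proper E V X (override_on d (\<lambda>_. x) W)"
  shows "recol E V X d (\<lambda>v. if v \<in> W then 1 else 0) (override_on d (\<lambda>_. x) W)"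
  using assms(1,2) p
proof (induction W)
  case empty
  then show ?case using recol.refl[of E V X d] by simp
next
  case (insert w W)
  have eq: "override_on d (\<lambda>_. x) (insert w W) = (override_on d (\<lambda>_. x) W)(w := x)"
    by (auto simp: override_on_def)
  have "proper E V X (override_on d (\<lambda>_. x) W)"
    using insert.prems assms(3) unfolding proper_def override_on_def image_subset_iff
    by (metis insertE insertI1 insertI2)
  then have "recol E V X d (\<lambda>v. if v \<in> W then 1 else 0) (override_on d (\<lambda>_. x) W)"
    using insert.IH insert.prems(1) by blast
  from recol.step[OF this, of w x]
  have "recol E V X d ((\<lambda>v. if v \<in> W then 1 else 0)(w := Suc 0)) (override_on d (\<lambda>_. x) (insert w W))"
    using insert.prems(1,2) insert.hyps(2) unfolding eq by (simp del: fun_upd_apply)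
  moreover have "((\<lambda>v. if v \<in> W then 1 else 0)(w := Suc 0)) = (\<lambda>v. if v \<in> insert w W then 1 else 0)"
    by auto
  ultimately show ?case by (simp del: fun_upd_apply)
qed

section \<open>Permuting the colors\<close>

text \<open>A color class acts as one vertex of a clique on \<open>{..<k}\<close>: proper colorings
  of the clique are injective, and moving a clique vertex recolors each vertex of its independent
  class once.\<close>

lemma recol_clique_classes:
  assumes "recol (\<noteq>) {..<k} X i m j" "proper E V {..<k} \<kappa>" "finite V"
  shows "\<exists>m'. recol E V X (override_on c (i \<circ> \<kappa>) V) m' (override_on c (j \<circ> \<kappa>) V) \<and>
    (\<forall>v \<in> V. m' v = m (\<kappa> v))"
proof -
  have comp: "proper E V X (override_on c (i \<circ> \<kappa>) V)" if "proper (\<noteq>) {..<k} X i" for i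
    using that assms(2) unfolding proper_def override_on_def
    by (simp add: image_subset_iff)
  show ?thesis
    using assms(1)
  proof (induction rule: recol.induct)
    case refl
    then show ?case using comp recol.refl by blast
  next
    case (step m j t x)
    let ?W = "{v \<in> V. \<kappa> v = t}"
    let ?d = "override_on c (j \<circ> \<kappa>) V"
    from step.IH obtain m' where m': "recol E V X (override_on c (i \<circ> \<kappa>) V) m' ?d"
      and cnt: "\<forall>v \<in> V. m' v = m (\<kappa> v)" by blast
    have eq: "override_on ?d (\<lambda>_. x) ?W = override_on c (j(t := x) \<circ> \<kappa>) V"
      by (auto simp: override_on_def)
    have "recol E V X ?d (\<lambda>v. if v \<in> ?W then 1 else 0) (override_on ?d (\<lambda>_. x) ?W)"
      using assms(3) recol_properD(2)[OF m'] comp[OF step.hyps(3)]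
      by (intro recol_independent) (auto simp: eq)
    from recol_trans[OF this m'] show ?case
      unfolding eq using cnt by (intro exI conjI) (assumption, auto)
  qed
qed

text \<open>
  A color class whose target color is held by no class moves there directly; when no such
  class is left, the target permutes the current colors and one class is parked on a free
  color, which opens its cycle.
\<close>

lemma recol_clique:
  assumes "k < card X" "inj_on i {..<k}" "i ` {..<k} \<subseteq> X" "inj_on j {..<k}" "j ` {..<k} \<subseteq> X"
  shows "\<exists>m j'. recol (\<noteq>) {..<k} X i m j' \<and> (\<forall>t<k. j' t = j t) \<and>
    (\<forall>t<k. m t \<le> (if i t = j t then 0 else if i t \<in> j ` {..<k} then 2 else 1))"
  using assms(2,3)
\<comment> \<open>The measure sums the claimed bounds: a class costs 0 on its own target, 2 while it
  occupies the target of another class, and 1 otherwise.\<close>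
proof (induction "\<Sum>t<k. if i t = j t then 0 else if i t \<in> j ` {..<k} then 2 else 1 :: nat"
    arbitrary: i rule: less_induct)
  case less
  define b where "b i t = (if i t = j t then 0 else if i t \<in> j ` {..<k} then 2 else 1 :: nat)" for i t
  have proper_inj: "proper (\<noteq>) {..<k} X i" if "inj_on i {..<k}" "i ` {..<k} \<subseteq> X" for i
    using that by (auto simp: proper_def inj_on_def)
  show ?case
  proof (cases "\<forall>t<k. i t = j t")
    case True
    then show ?thesis
      using recol.refl[OF proper_inj[OF less.prems]] by auto
  next
    case False
    \<comment> \<open>Moving class \<open>t\<close> to a free color changes no other summand, so a
      drop in the summand of \<open>t\<close> pays for the move.\<close>
    have move: ?thesis
      if t: "t < k" and x: "x \<in> X" "x \<notin> i ` {..<k}" and dec: "b (i(t := x)) t < b i t" for t x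
    proof -
      let ?i = "i(t := x)"
      have inj: "inj_on ?i {..<k}"
        using less.prems(1) x(2) by (auto simp: inj_on_def)
      have sub: "?i ` {..<k} \<subseteq> X" using less.prems(2) x(1) by auto
      have "(\<Sum>s<k. b ?i s) < (\<Sum>s<k. b i s)"
      proof (rule sum_strict_mono_ex1)
        have "b ?i s = b i s" if "s \<noteq> t" for s using that by (simp add: b_def)
        then show "\<forall>s\<in>{..<k}. b ?i s \<le> b i s" using dec by (metis less_imp_le order_refl)
        show "\<exists>s\<in>{..<k}. b ?i s < b i s" using dec t by blast
      qed simp
      from less.hyps[OF this[unfolded b_def] inj sub]
      obtain m j' where m: "recol (\<noteq>) {..<k} X ?i m j'" "\<forall>t<k. j' t = j t" "\<forall>s<k. m s \<le> b ?i s"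
        unfolding b_def by blast
      have "recol (\<noteq>) {..<k} X i ((\<lambda>_. 0)(t := Suc 0)) ?i"
        using recol.step[OF recol.refl[OF proper_inj[OF less.prems]], of t x] t proper_inj[OF inj sub]
        by simp
      from recol_trans[OF m(1) this]
      have r: "recol (\<noteq>) {..<k} X i (\<lambda>v. ((\<lambda>_. 0)(t := Suc 0)) v + m v) j'" .
      have "((\<lambda>_. 0)(t := Suc 0)) s + m s \<le> b i s" if "s < k" for s
      proof (cases "s = t")
        case True
        then show ?thesis using m(3) t dec by (auto dest!: spec[of _ t])
      next
        case False
        then have "b ?i s = b i s" by (simp add: b_def)
        then show ?thesis using m(3) that False by (auto dest!: spec[of _ s])
      qed
      then show ?thesis using r m(2) unfolding b_def by blast
    qed
    show ?thesis
    proof (cases "\<exists>t<k. i t \<noteq> j t \<and> j t \<notin> i ` {..<k}")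
      case True
      then obtain t where "t < k" "i t \<noteq> j t" "j t \<notin> i ` {..<k}" by blast
      then show ?thesis using assms(5) by (intro move[of t "j t"]) (simp_all add: b_def image_subset_iff)
    next
      case nofree: False
      from False obtain t where t: "t < k" "i t \<noteq> j t" by blast
      have "j ` {..<k} \<subseteq> i ` {..<k}"
      proof (rule image_subsetI)
        show "j t \<in> i ` {..<k}" if "t \<in> {..<k}" for t
          using nofree that by (cases "i t = j t") force+
      qed
      then have same: "j ` {..<k} = i ` {..<k}"
        using less.prems(1) assms(4) by (intro card_subset_eq) (auto simp: card_image)
      have "\<not> X \<subseteq> i ` {..<k}"
        using assms(1) less.prems(1) card_mono[of "i ` {..<k}" X] by (auto simp: card_image)
      then obtain x where x: "x \<in> X" "x \<notin> i ` {..<k}" by blast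
      \<comment> \<open>A parked class no longer occupies a target color, so its cost falls from 2
        to 1.\<close>
      have "b (i(t := x)) t \<le> 1" using x(2) same by (simp add: b_def)
      moreover have "b i t = 2" using t same by (simp add: b_def)
      ultimately show ?thesis using t(1) x by (intro move[of t x]) auto
    qed
  qed
qed

lemma recol_permute:
  assumes "proper E V {..<k} \<kappa>" "finite V" "k < card X"
    and "inj_on i {..<k}" "i ` {..<k} \<subseteq> X" "inj_on j {..<k}" "j ` {..<k} \<subseteq> X"
  shows "\<exists>m. recol E V X (override_on c (i \<circ> \<kappa>) V) m (override_on c (j \<circ> \<kappa>) V) \<and>
    (\<forall>v \<in> V. m v \<le> 2)"
proof -
  obtain m j' where m: "recol (\<noteq>) {..<k} X i m j'" "\<forall>t<k. j' t = j t" and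
    b: "\<forall>t<k. m t \<le> (if i t = j t then 0 else if i t \<in> j ` {..<k} then 2 else 1)"
    using recol_clique[OF assms(3-)] by blast
  have two: "m t \<le> 2" if "t < k" for t
    using b that by (auto dest!: spec[of _ t] split: if_splits)
  have dom: "\<kappa> v < k" if "v \<in> V" for v using assms(1) that by (auto simp: proper_def)
  \<comment> \<open>\<open>j'\<close> is known to equal \<open>j\<close> only below
    \<open>k\<close>, which is where \<open>\<kappa>\<close> takes its values.\<close>
  have "override_on c (j' \<circ> \<kappa>) V = override_on c (j \<circ> \<kappa>) V"
    using m(2) dom by (auto simp: override_on_def)
  then obtain m' where "recol E V X (override_on c (i \<circ> \<kappa>) V) m' (override_on c (j \<circ> \<kappa>) V)"
    "\<forall>v \<in> V. m' v = m (\<kappa> v)"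
    using recol_clique_classes[OF m(1) assms(1,2), of c] by auto
  then show ?thesis using two dom by auto
qed

section \<open>Canonical colorings\<close>

text \<open>The first two conjuncts make \<open>k\<close> the chromatic number. The classes of
  \<open>\<kappa>\<close> are fixed in advance, while their colors \<open>i\<close> depend on the
  start \<open>c\<close>. The bound \<open>m v < card V\<close> grows with the graph, so that added
  vertices pay for added recolorings.\<close>

definition canonical :: "('v \<Rightarrow> 'v \<Rightarrow> bool) \<Rightarrow> 'v set \<Rightarrow> ('v \<Rightarrow> nat) \<Rightarrow> nat \<Rightarrow> bool" where
  "canonical E V \<kappa> k \<longleftrightarrow> proper E V {..<k} \<kappa> \<and>
     (\<forall>X c. finite X \<longrightarrow> proper E V X c \<longrightarrow> k \<le> card X) \<and>
     (\<forall>X c. k < card X \<longrightarrow> proper E V X c \<longrightarrow>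
       (\<exists>i m. inj_on i {..<k} \<and> i ` {..<k} \<subseteq> X \<and>
         recol E V X c m (override_on c (i \<circ> \<kappa>) V) \<and> (\<forall>v \<in> V. m v < card V)))"

lemma canonicalD:
  assumes "canonical E V \<kappa> k"
  shows "proper E V {..<k} \<kappa>"
    and "finite X \<Longrightarrow> proper E V X c \<Longrightarrow> k \<le> card X"
    and "k < card X \<Longrightarrow> proper E V X c \<Longrightarrow>
       \<exists>i m. inj_on i {..<k} \<and> i ` {..<k} \<subseteq> X \<and>
         recol E V X c m (override_on c (i \<circ> \<kappa>) V) \<and> (\<forall>v \<in> V. m v < card V)"
  using assms unfolding canonical_def by blast+

lemma proper_subset: "proper E V X c \<Longrightarrow> W \<subseteq> V \<Longrightarrow> c ` W \<subseteq> Y \<Longrightarrow> proper E W Y c"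
  unfolding proper_def by blast

lemma card_pos_finite: "k < card X \<Longrightarrow> finite X"
  using card_ge_0_finite by force

lemma canonical_empty: "canonical E {} \<kappa> 0"
proof -
  have "recol E {} X c (\<lambda>_. 0) c" for X and c :: "'a \<Rightarrow> nat"
    by (rule recol.refl) (simp add: proper_def)
  then show ?thesis by (auto simp: canonical_def proper_def)
qed

lemma canonical_singleton:
  assumes "irreflp E"
  shows "canonical E {w} (\<lambda>_. 0) 1"
  unfolding canonical_def
proof (intro conjI allI impI)
  show "proper E {w} {..<1} (\<lambda>_. 0)" using assms by (auto simp: proper_def irreflp_def)
next
  fix X and c :: "'a \<Rightarrow> nat"
  assume "finite X" "proper E {w} X c"
  then show "1 \<le> card X" by (auto simp: proper_def Suc_le_eq card_gt_0_iff)
next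
  fix X and c :: "'a \<Rightarrow> nat"
  assume p: "proper E {w} X c"
  have eq: "override_on c ((\<lambda>_. c w) \<circ> (\<lambda>_. 0 :: nat)) {w} = c" by (auto simp: override_on_def)
  show "\<exists>i m. inj_on i {..<1 :: nat} \<and> i ` {..<1} \<subseteq> X \<and>
      recol E {w} X c m (override_on c (i \<circ> (\<lambda>_. 0)) {w}) \<and> (\<forall>v \<in> {w}. m v < card {w})"
    by (rule exI[of _ "\<lambda>_. c w"], rule exI[of _ "\<lambda>_. 0"])
      (use p recol.refl[OF p] eq in \<open>simp add: proper_def inj_on_def image_subset_iff\<close>)
qed

subsection \<open>Comparable vertices\<close>

text \<open>Neighbors of \<open>w\<close> are neighbors of \<open>s\<close> and so avoid the color
  of \<open>s\<close>; \<open>s\<close> itself is not among them, as it would then be its own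
  neighbor.\<close>

lemma proper_copy:
  assumes "symp E" "proper E (V - {w}) X d" "s \<in> V" "s \<noteq> w" "\<forall>u \<in> V. E w u \<longrightarrow> E s u" "irreflp E"
  shows "proper E V X (d(w := d s))"
proof -
  have col: "d u \<in> X" if "u \<in> V" "u \<noteq> w" for u using assms(2) that by (auto simp: proper_def)
  have ne: "d u \<noteq> d v" if "u \<in> V" "v \<in> V" "u \<noteq> w" "v \<noteq> w" "E u v" for u v
    using assms(2) that by (auto simp: proper_def)
  have sw: "\<not> E w w" using assms(6) by (simp add: irreflp_def)
  have key: "d s \<noteq> d v" if "v \<in> V" "E w v" for v
    using that assms(3,4,5) ne[of s v] sw by metis
  have key': "d u \<noteq> d s" if "u \<in> V" "E u w" for u
    using key[OF that(1) sympD[OF assms(1) that(2)]] by simp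
  show ?thesis
    unfolding proper_def using col[OF assms(3,4)] col ne key key' sw by auto
qed

text \<open>Every move of \<open>s\<close> is followed by the same move of \<open>w\<close>.\<close>

lemma recol_copy:
  assumes "symp E" "irreflp E" "s \<in> V" "w \<in> V" "s \<noteq> w" "\<forall>u \<in> V. E w u \<longrightarrow> E s u"
    and "recol E (V - {w}) X c m d"
  shows "recol E V X (c(w := c s)) (m(w := m s)) (d(w := d s))"
  using assms(7)
proof (induction rule: recol.induct)
  case refl
  have "((\<lambda>_. 0 :: nat)(w := 0)) = (\<lambda>_. 0)" by auto
  then show ?case
    using recol.refl[OF proper_copy[OF assms(1) refl assms(3,5,6,2)]] by (simp del: fun_upd_apply)
next
  case (step m d v x)
  note cp = proper_copy[OF assms(1) _ assms(3,5,6,2)]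
  have v: "v \<in> V" "v \<noteq> w" using step.hyps(2) by auto
  have pn: "proper E V X ((d(v := x))(w := (d(v := x)) s))" by (rule cp[OF step.hyps(3)])
  have po: "proper E V X (d(w := d s))" by (rule recol_properD(2)[OF step.IH])
  show ?case
  proof (cases "v = s")
    case False
    have "((d(v := x))(w := (d(v := x)) s)) = (d(w := d s))(v := x)"
      "((m(v := Suc (m v)))(w := (m(v := Suc (m v))) s)) = (m(w := m s))(v := Suc ((m(w := m s)) v))"
      using False v by auto
    then show ?thesis
      using recol.step[OF step.IH v(1), of x] pn by (simp del: fun_upd_apply)
  next
    case True
    have a: "((d(v := x))(w := (d(v := x)) s)) = ((d(w := d s))(v := x))(w := x)"
      using True v by auto
    have b: "((m(v := Suc (m v)))(w := (m(v := Suc (m v))) s)) =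
        ((m(w := m s))(v := Suc ((m(w := m s)) v)))
          (w := Suc (((m(w := m s))(v := Suc ((m(w := m s)) v))) w))"
      using True v by auto
    \<comment> \<open>This is the coloring after \<open>s\<close> has moved and before
      \<open>w\<close> follows. As \<open>s\<close> and \<open>w\<close> are nonadjacent, edges at
      \<open>s\<close> look as in the coloring of \<open>pn\<close>, all others as in that of
      \<open>po\<close>.\<close>
    have "proper E V X ((d(w := d s))(v := x))"
      unfolding proper_def
    proof (intro conjI ballI impI)
      show "(d(w := d s))(v := x) ` V \<subseteq> X"
      proof (rule image_subsetI)
        have "x \<in> X" using step.hyps(2,3) unfolding proper_def by auto
        moreover have "(d(w := d s)) u \<in> X" if "u \<in> V" for u
          using po that unfolding proper_def by blast
        ultimately show "((d(w := d s))(v := x)) u \<in> X" if "u \<in> V" for u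
          using that by simp
      qed
      fix u u' assume u: "u \<in> V" "u' \<in> V" "E u u'"
      have "\<not> E s s" using assms(2) by (simp add: irreflp_def)
      then have nsw: "\<not> E s w" "\<not> E w s"
        using assms(3,6) sympD[OF assms(1), of s w] by blast+
      show "((d(w := d s))(v := x)) u \<noteq> ((d(w := d s))(v := x)) u'"
      proof (cases "u = s \<or> u' = s")
        case True
        then have "u \<noteq> w" "u' \<noteq> w" using u nsw assms(5) by auto
        moreover have "((d(v := x))(w := (d(v := x)) s)) u \<noteq> ((d(v := x))(w := (d(v := x)) s)) u'"
          using pn u unfolding proper_def by blast
        ultimately show ?thesis by (simp split: if_splits)
      next
        case False
        moreover have "(d(w := d s)) u \<noteq> (d(w := d s)) u'"
          using po u unfolding proper_def by blast
        ultimately show ?thesis using \<open>v = s\<close> by simp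
      qed
    qed
    from recol.step[OF recol.step[OF step.IH v(1) this] assms(4), of x] show ?thesis
      using pn unfolding a b by blast
  qed
qed

text \<open>One recoloring gives \<open>w\<close> the color of \<open>s\<close>, and from then on
  \<open>w\<close> follows \<open>s\<close>. The count of \<open>w\<close> exceeds that of
  \<open>s\<close> by one, which the added vertex pays for; \<open>w\<close> joins the class of
  \<open>s\<close>, so \<open>k\<close> does not change.\<close>

lemma canonical_comparable:
  assumes "symp E" "irreflp E" "finite V" "s \<in> V" "w \<in> V" "s \<noteq> w" "\<forall>u \<in> V. E w u \<longrightarrow> E s u"
    and can: "canonical E (V - {w}) \<kappa> k"
  shows "canonical E V (\<kappa>(w := \<kappa> s)) k"
  unfolding canonical_def
proof (intro conjI allI impI)
  show "proper E V {..<k} (\<kappa>(w := \<kappa> s))"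
    using proper_copy[OF assms(1) canonicalD(1)[OF can] assms(4,6,7,2)] .
  have restrict: "proper E (V - {w}) X c" if "proper E V X c" for X c
    using that by (auto simp: proper_def)
  fix X c
  {
    assume "finite X" "proper E V X c"
    then show "k \<le> card X" using canonicalD(2)[OF can] restrict by blast
  }
  assume k: "k < card X" and c: "proper E V X c"
  obtain i m where i: "inj_on i {..<k}" "i ` {..<k} \<subseteq> X"
    and m: "recol E (V - {w}) X c m (override_on c (i \<circ> \<kappa>) (V - {w}))"
    and cnt: "\<forall>v \<in> V - {w}. m v < card (V - {w})"
    using canonicalD(3)[OF can k restrict[OF c]] by blast
  have "recol E V X c ((\<lambda>_. 0)(w := Suc 0)) (c(w := c s))"
    using recol.step[OF recol.refl[OF c] assms(5)]
      proper_copy[OF assms(1) restrict[OF c] assms(4,6,7,2)] by (simp del: fun_upd_apply)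
  from recol_trans[OF recol_copy[OF assms(1,2,4-7) m] this]
  have "recol E V X c (\<lambda>v. ((\<lambda>_. 0)(w := Suc 0)) v + (m(w := m s)) v)
      ((override_on c (i \<circ> \<kappa>) (V - {w}))(w := override_on c (i \<circ> \<kappa>) (V - {w}) s))" .
  moreover have "(override_on c (i \<circ> \<kappa>) (V - {w}))(w := override_on c (i \<circ> \<kappa>) (V - {w}) s) =
      override_on c (i \<circ> \<kappa>(w := \<kappa> s)) V"
    using assms(4-6) by (auto simp: override_on_def)
  moreover have "\<forall>v \<in> V. ((\<lambda>_. 0)(w := Suc 0)) v + (m(w := m s)) v < card V"
  proof
    fix v assume "v \<in> V"
    have card: "card V = Suc (card (V - {w}))" using assms(3,5) by (metis card.remove)
    have "m s < card (V - {w})" using cnt assms(4,6) by blast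
    moreover have "m v < card (V - {w})" if "v \<noteq> w" using cnt \<open>v \<in> V\<close> that by blast
    ultimately show "((\<lambda>_. 0)(w := Suc 0)) v + (m(w := m s)) v < card V"
      unfolding card by (cases "v = w") (simp_all add: less_SucI del: card_Diff_insert)
  qed
  ultimately show "\<exists>i m. inj_on i {..<k} \<and> i ` {..<k} \<subseteq> X \<and>
      recol E V X c m (override_on c (i \<circ> \<kappa>(w := \<kappa> s)) V) \<and> (\<forall>v \<in> V. m v < card V)"
    using i by auto
qed

subsection \<open>Disjoint unions\<close>

text \<open>Each side is brought to its own classes, after which the classes of \<open>B\<close>
  move to the first \<open>k2\<close> colors chosen for \<open>A\<close>. This alignment costs up to
  2 more per vertex of \<open>B\<close>, hence \<open>2 \<le> card A\<close>.\<close>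

lemma canonical_disjoint_union:
  assumes "symp E" "finite A" "finite B" "A \<inter> B = {}" "2 \<le> card A" "B \<noteq> {}"
    and no: "\<And>a b. a \<in> A \<Longrightarrow> b \<in> B \<Longrightarrow> \<not> E a b"
    and A: "canonical E A \<kappa>1 k1" and B: "canonical E B \<kappa>2 k2" and le: "k2 \<le> k1"
  shows "canonical E (A \<union> B) (override_on \<kappa>2 \<kappa>1 A) k1"
proof -
  let ?\<kappa> = "override_on \<kappa>2 \<kappa>1 A"
  have union: "proper E (A \<union> B) X c" if "proper E A X c" "proper E B X c" for X c
    using that no assms(1) unfolding proper_def symp_def image_subset_iff by blast
  show ?thesis
    unfolding canonical_def
  proof (intro conjI allI impI)
    have \<kappa>A: "?\<kappa> a = \<kappa>1 a" if "a \<in> A" for a using that by simp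
    have \<kappa>B: "?\<kappa> b = \<kappa>2 b" if "b \<in> B" for b using that assms(4) by (auto simp: override_on_def)
    have "proper E A {..<k1} ?\<kappa>"
      using canonicalD(1)[OF A] \<kappa>A by (auto simp: proper_def)
    moreover have "proper E B {..<k1} ?\<kappa>"
      using canonicalD(1)[OF B] \<kappa>B le by (fastforce simp: proper_def)
    ultimately show "proper E (A \<union> B) {..<k1} ?\<kappa>" by (rule union)
    fix X c
    {
      assume "finite X" "proper E (A \<union> B) X c"
      then show "k1 \<le> card X"
        using canonicalD(2)[OF A] by (metis (no_types, lifting) Un_upper1 image_Un le_sup_iff proper_def proper_subset)
    }
    assume k: "k1 < card X" and c: "proper E (A \<union> B) X c"
    have k2: "k2 < card X" using k le by simp
    have cA: "proper E A X c" using c by (rule proper_subset) (use c in \<open>auto simp: proper_def\<close>)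
    obtain i1 m1 where i1: "inj_on i1 {..<k1}" "i1 ` {..<k1} \<subseteq> X"
      and m1: "recol E A X c m1 (override_on c (i1 \<circ> \<kappa>1) A)" "\<forall>v \<in> A. m1 v < card A"
      using canonicalD(3)[OF A k cA] by blast
    let ?c1 = "override_on c (i1 \<circ> \<kappa>1) A"
    have r1: "recol E (A \<union> B) X c m1 ?c1"
      using m1(1) by (rule recol_mono) (use assms(1) c no symp_def in \<open>auto, metis\<close>)
    have c1: "proper E (A \<union> B) X ?c1" by (rule recol_properD(2)[OF r1])
    have c1B: "proper E B X ?c1" using c1 by (rule proper_subset) (use c1 in \<open>auto simp: proper_def\<close>)
    obtain i2 m2 where i2: "inj_on i2 {..<k2}" "i2 ` {..<k2} \<subseteq> X"
      and m2: "recol E B X ?c1 m2 (override_on ?c1 (i2 \<circ> \<kappa>2) B)" "\<forall>v \<in> B. m2 v < card B"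
      using canonicalD(3)[OF B k2 c1B] by blast
    let ?c2 = "override_on ?c1 (i2 \<circ> \<kappa>2) B"
    let ?c3 = "override_on ?c1 (i1 \<circ> \<kappa>2) B"
    have i1': "inj_on i1 {..<k2}" "i1 ` {..<k2} \<subseteq> X"
      using i1 le by (auto intro: inj_on_subset)
    obtain m3 where m3: "recol E B X ?c2 m3 ?c3" "\<forall>v \<in> B. m3 v \<le> 2"
      using recol_permute[OF canonicalD(1)[OF B] assms(3) k2 i2 i1'] by blast
    have "recol E B X ?c1 (\<lambda>v. m2 v + m3 v) ?c3" by (rule recol_trans[OF m3(1) m2(1)])
    then have "recol E (A \<union> B) X ?c1 (\<lambda>v. m2 v + m3 v) ?c3"
      by (rule recol_mono) (use assms(1) c1 no in auto)
    from recol_trans[OF this r1]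
    have r: "recol E (A \<union> B) X c (\<lambda>v. m1 v + (m2 v + m3 v)) ?c3" .
    have eq: "?c3 = override_on c (i1 \<circ> ?\<kappa>) (A \<union> B)"
      using assms(4) by (auto simp: override_on_def fun_eq_iff)
    have "m1 v + (m2 v + m3 v) < card (A \<union> B)" if "v \<in> A \<union> B" for v
    proof -
      have card: "card (A \<union> B) = card A + card B" using assms(2-4) by (simp add: card_Un_disjoint)
      have "card B > 0" using assms(3,6) by (simp add: card_gt_0_iff)
      show ?thesis
      proof (cases "v \<in> A")
        case True
        then have "v \<notin> B" using assms(4) by auto
        then have "m2 v = 0" "m3 v = 0" using recol_outside[OF m2(1)] recol_outside[OF m3(1)] by auto
        then show ?thesis using True m1(2) card by auto
      next
        case False
        then have "m1 v = 0" "v \<in> B" using recol_outside[OF m1(1)] that by auto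
        then have "m2 v < card B" "m3 v \<le> 2" using m2(2) m3(2) by auto
        then show ?thesis using card \<open>m1 v = 0\<close> assms(5) by linarith
      qed
    qed
    then show "\<exists>i m. inj_on i {..<k1} \<and> i ` {..<k1} \<subseteq> X \<and>
        recol E (A \<union> B) X c m (override_on c (i \<circ> ?\<kappa>) (A \<union> B)) \<and> (\<forall>v \<in> A \<union> B. m v < card (A \<union> B))"
      using i1 r unfolding eq by blast
  qed
qed

subsection \<open>Joins\<close>

text \<open>
  When the colors not used on \<open>B\<close> leave room on \<open>A\<close>, first \<open>A\<close> shrinks to its chromatic
  number of colors, which in turn leaves room on \<open>B\<close>.
\<close>

lemma recol_join:
  assumes "symp E" "finite A" "finite B" "A \<inter> B = {}"
    and full: "\<forall>a \<in> A. \<forall>b \<in> B. E a b"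
    and A: "canonical E A \<kappa>1 k1" and B: "canonical E B \<kappa>2 k2"
    and k: "k1 + k2 < card X" and c: "proper E (A \<union> B) X c" and room: "k1 < card (X - c ` B)"
  shows "\<exists>i1 i2 m. inj_on i1 {..<k1} \<and> inj_on i2 {..<k2} \<and> i1 ` {..<k1} \<subseteq> X \<and> i2 ` {..<k2} \<subseteq> X \<and>
    i1 ` {..<k1} \<inter> i2 ` {..<k2} = {} \<and>
    recol E (A \<union> B) X c m (override_on (override_on c (i1 \<circ> \<kappa>1) A) (i2 \<circ> \<kappa>2) B) \<and>
    (\<forall>v \<in> A \<union> B. m v < card (A \<union> B))"
proof -
  have finX: "finite X" by (rule card_pos_finite[OF k])
  \<comment> \<open>In a join no color occurs on both sides, so \<open>A\<close> is colored from the
    palette left by \<open>B\<close>.\<close>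
  have cA: "proper E A (X - c ` B) c"
    using c by (rule proper_subset) (use c full in \<open>fastforce simp: proper_def\<close>)+
  obtain i1 m1 where i1: "inj_on i1 {..<k1}" "i1 ` {..<k1} \<subseteq> X - c ` B"
    and m1: "recol E A (X - c ` B) c m1 (override_on c (i1 \<circ> \<kappa>1) A)" "\<forall>v \<in> A. m1 v < card A"
    using canonicalD(3)[OF A room cA] by blast
  let ?c1 = "override_on c (i1 \<circ> \<kappa>1) A"
  have r1: "recol E (A \<union> B) X c m1 ?c1"
    using m1(1) by (rule recol_mono) (use assms(1) c in auto)
  have c1: "proper E (A \<union> B) X ?c1" by (rule recol_properD(2)[OF r1])
  \<comment> \<open>All colors on \<open>A\<close> now lie in the image of \<open>i1\<close>, which
    leaves more than \<open>k2\<close> colors to \<open>B\<close>.\<close>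
  let ?X2 = "X - i1 ` {..<k1}"
  have "card (i1 ` {..<k1}) = k1" using i1(1) by (simp add: card_image)
  then have k2: "k2 < card ?X2"
    using k i1(2) finX by (subst card_Diff_subset) auto
  have "?c1 ` B = c ` B" using assms(4) by (auto simp: override_on_def)
  then have "?c1 ` B \<subseteq> ?X2" using i1(2) c by (auto simp: proper_def)
  then have c1B: "proper E B ?X2 ?c1" using c1 by (intro proper_subset[OF c1]) auto
  obtain i2 m2 where i2: "inj_on i2 {..<k2}" "i2 ` {..<k2} \<subseteq> ?X2"
    and m2: "recol E B ?X2 ?c1 m2 (override_on ?c1 (i2 \<circ> \<kappa>2) B)" "\<forall>v \<in> B. m2 v < card B"
    using canonicalD(3)[OF B k2 c1B] by blast
  have r2: "recol E (A \<union> B) X ?c1 m2 (override_on ?c1 (i2 \<circ> \<kappa>2) B)"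
    using m2(1)
  proof (rule recol_mono)
    fix u v assume "u \<in> A \<union> B - B"
    then have "?c1 u = i1 (\<kappa>1 u)" "\<kappa>1 u < k1" using canonicalD(1)[OF A] by (auto simp: proper_def)
    then show "?c1 u \<notin> ?X2" by auto
  qed (use assms(1) c1 in auto)
  have "m1 v + m2 v < card (A \<union> B)" if "v \<in> A \<union> B" for v
  proof -
    have card: "card (A \<union> B) = card A + card B" using assms(2-4) by (simp add: card_Un_disjoint)
    show ?thesis
    proof (cases "v \<in> A")
      case True
      then have "m2 v = 0" using assms(4) recol_outside[OF m2(1)] by auto
      then show ?thesis using True m1(2) card by auto
    next
      case False
      then show ?thesis using that recol_outside[OF m1(1)] m2(2) card by auto
    qed
  qed
  then have cnt: "\<forall>v \<in> A \<union> B. m1 v + m2 v < card (A \<union> B)" by blast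
  show ?thesis
    by (rule exI[of _ i1], rule exI[of _ i2], rule exI[of _ "\<lambda>v. m1 v + m2 v"])
      (use i1 i2 recol_trans[OF r2 r1] cnt in blast)
qed

text \<open>The sides use disjoint sets of colors, so the chromatic numbers add. Of more than
  \<open>k1 + k2\<close> colors, either more than \<open>k1\<close> are missing on \<open>B\<close>,
  or more than \<open>k2\<close> occur on \<open>B\<close> and are therefore missing on
  \<open>A\<close>; accordingly \<open>recol_join\<close> starts with \<open>A\<close> or with
  \<open>B\<close>.\<close>

lemma canonical_join:
  assumes "symp E" "finite A" "finite B" "A \<inter> B = {}"
    and full: "\<forall>a \<in> A. \<forall>b \<in> B. E a b"
    and A: "canonical E A \<kappa>1 k1" and B: "canonical E B \<kappa>2 k2"
  shows "canonical E (A \<union> B) (override_on (\<lambda>v. k1 + \<kappa>2 v) \<kappa>1 A) (k1 + k2)"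
proof -
  let ?\<kappa> = "override_on (\<lambda>v. k1 + \<kappa>2 v) \<kappa>1 A"
  have \<kappa>1: "\<kappa>1 a < k1" if "a \<in> A" for a using canonicalD(1)[OF A] that by (auto simp: proper_def)
  have \<kappa>2: "\<kappa>2 b < k2" if "b \<in> B" for b using canonicalD(1)[OF B] that by (auto simp: proper_def)
  have full': "\<forall>b \<in> B. \<forall>a \<in> A. E b a" using full assms(1) by (simp add: sympD)
  have split: "proper E A (c ` A) c" "proper E B (c ` B) c" "c ` A \<inter> c ` B = {}" "c ` A \<union> c ` B \<subseteq> X"
    if "proper E (A \<union> B) X c" for X c
    using that full unfolding proper_def by (blast, blast, force, blast)
  show ?thesis
    unfolding canonical_def
  proof (intro conjI allI impI)
    show "proper E (A \<union> B) {..<k1 + k2} ?\<kappa>"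
      unfolding proper_def
    proof (intro conjI ballI impI)
      show "?\<kappa> ` (A \<union> B) \<subseteq> {..<k1 + k2}" using \<kappa>1 \<kappa>2 by (fastforce simp: override_on_def)
      fix u v assume uv: "u \<in> A \<union> B" "v \<in> A \<union> B" "E u v"
      then show "?\<kappa> u \<noteq> ?\<kappa> v"
        using canonicalD(1)[OF A] canonicalD(1)[OF B] \<kappa>1[of u] \<kappa>1[of v]
        by (auto simp: override_on_def proper_def)
    qed
    fix X c
    {
      assume X: "finite X" and c: "proper E (A \<union> B) X c"
      have "k1 \<le> card (c ` A)" "k2 \<le> card (c ` B)"
        using canonicalD(2)[OF A _ split(1)[OF c]] canonicalD(2)[OF B _ split(2)[OF c]] assms(2,3) by auto
      moreover have "card (c ` A) + card (c ` B) \<le> card X"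
        using split(3)[OF c] card_mono[OF X split(4)[OF c]] assms(2,3) by (simp add: card_Un_disjoint)
      ultimately show "k1 + k2 \<le> card X" by simp
    }
    assume k: "k1 + k2 < card X" and c: "proper E (A \<union> B) X c"
    have X: "finite X" by (rule card_pos_finite[OF k])
    have "\<exists>i1 i2 m. inj_on i1 {..<k1} \<and> inj_on i2 {..<k2} \<and> i1 ` {..<k1} \<subseteq> X \<and> i2 ` {..<k2} \<subseteq> X \<and>
      i1 ` {..<k1} \<inter> i2 ` {..<k2} = {} \<and>
      recol E (A \<union> B) X c m (override_on (override_on c (i1 \<circ> \<kappa>1) A) (i2 \<circ> \<kappa>2) B) \<and>
      (\<forall>v \<in> A \<union> B. m v < card (A \<union> B))" (is "?P")
    proof (cases "k1 < card (X - c ` B)")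
      case True
      show ?thesis by (rule recol_join[OF assms k c True])
    next
      case False
      have "card X = card (X - c ` B) + card (c ` B)"
        using split(4)[OF c] X assms(3) by (simp add: card_Diff_subset card_mono)
      moreover have "card (c ` B) \<le> card (X - c ` A)"
        using split(3,4)[OF c] X by (intro card_mono) auto
      ultimately have room: "k2 < card (X - c ` A)" using False k by linarith
      have comm: "B \<union> A = A \<union> B" "B \<inter> A = {}" "k2 + k1 < card X"
        using assms(4) k by auto
      have "proper E (B \<union> A) X c" using c comm(1) by simp
      from recol_join[OF assms(1,3,2) comm(2) full' B A comm(3) this room]
      obtain i2 i1 m where i12: "inj_on i2 {..<k2}" "inj_on i1 {..<k1}" "i2 ` {..<k2} \<subseteq> X" "i1 ` {..<k1} \<subseteq> X"
        and dis: "i2 ` {..<k2} \<inter> i1 ` {..<k1} = {}"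
        and r: "recol E (B \<union> A) X c m (override_on (override_on c (i2 \<circ> \<kappa>2) B) (i1 \<circ> \<kappa>1) A)"
        and cnt: "\<forall>v \<in> B \<union> A. m v < card (B \<union> A)"
        by (elim exE conjE) (rule that)
      have eq: "override_on (override_on c (i2 \<circ> \<kappa>2) B) (i1 \<circ> \<kappa>1) A =
          override_on (override_on c (i1 \<circ> \<kappa>1) A) (i2 \<circ> \<kappa>2) B"
        using assms(4) by (auto simp: override_on_def fun_eq_iff)
      show ?thesis
        by (rule exI[of _ i1], rule exI[of _ i2], rule exI[of _ m])
          (use i12 r cnt dis in \<open>simp add: comm(1) eq Int_commute\<close>)
    qed
    then obtain i1 i2 m where inj: "inj_on i1 {..<k1}" "inj_on i2 {..<k2}"
      and sub: "i1 ` {..<k1} \<subseteq> X" "i2 ` {..<k2} \<subseteq> X" and dis: "i1 ` {..<k1} \<inter> i2 ` {..<k2} = {}"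
      and r: "recol E (A \<union> B) X c m (override_on (override_on c (i1 \<circ> \<kappa>1) A) (i2 \<circ> \<kappa>2) B)"
      and cnt: "\<forall>v \<in> A \<union> B. m v < card (A \<union> B)"
      by (elim exE conjE) (rule that)
    \<comment> \<open>The classes of \<open>B\<close> are numbered from \<open>k1\<close> on, as in
      \<open>?\<kappa>\<close>.\<close>
    define i where "i t = (if t < k1 then i1 t else i2 (t - k1))" for t
    have dis': "i1 s \<noteq> i2 t" if "s < k1" "t < k2" for s t using dis that by auto
    have "inj_on i {..<k1 + k2}"
    proof (rule inj_onI)
      fix s t assume st: "s \<in> {..<k1 + k2}" "t \<in> {..<k1 + k2}" "i s = i t"
      then have "s < k1 \<or> k1 \<le> s \<and> s - k1 < k2" "t < k1 \<or> k1 \<le> t \<and> t - k1 < k2" by auto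
      then show "s = t"
        using st(3) inj_onD[OF inj(1), of s t] inj_onD[OF inj(2), of "s - k1" "t - k1"]
          dis'[of s "t - k1"] dis'[of t "s - k1"]
        by (auto simp: i_def split: if_splits)
    qed
    moreover have "i ` {..<k1 + k2} \<subseteq> X" using sub by (auto simp: i_def image_subset_iff)
    moreover have "override_on (override_on c (i1 \<circ> \<kappa>1) A) (i2 \<circ> \<kappa>2) B = override_on c (i \<circ> ?\<kappa>) (A \<union> B)"
      using \<kappa>1 assms(4) by (auto simp: override_on_def fun_eq_iff i_def)
    ultimately show "\<exists>i m. inj_on i {..<k1 + k2} \<and> i ` {..<k1 + k2} \<subseteq> X \<and>
        recol E (A \<union> B) X c m (override_on c (i \<circ> ?\<kappa>) (A \<union> B)) \<and> (\<forall>v \<in> A \<union> B. m v < card (A \<union> B))"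
      using r cnt by (intro exI[of _ i] exI[of _ m]) simp
  qed
qed

section \<open>Decomposing graphs of the class\<close>

text \<open>
  The disjuncts are \<open>P5\<close>, \<open>C5\<close>, the house with square \<open>abcd\<close> and roof \<open>e\<close>, and the co-banner;
  in each of them the adjacencies force the five vertices to be distinct if \<open>E\<close> is symmetric
  and irreflexive.
\<close>

definition forbidden :: "('v \<Rightarrow> 'v \<Rightarrow> bool) \<Rightarrow> 'v \<Rightarrow> 'v \<Rightarrow> 'v \<Rightarrow> 'v \<Rightarrow> 'v \<Rightarrow> bool" where
  "forbidden E a b c d e \<longleftrightarrow>
     (E a b \<and> E b c \<and> E c d \<and> E d e \<and>
        \<not> E a c \<and> \<not> E a d \<and> \<not> E a e \<and> \<not> E b d \<and> \<not> E b e \<and> \<not> E c e) \<or>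
     (E a b \<and> E b c \<and> E c d \<and> E d e \<and> E e a \<and>
        \<not> E a c \<and> \<not> E a d \<and> \<not> E b d \<and> \<not> E b e \<and> \<not> E c e) \<or>
     (E a b \<and> E b c \<and> E c d \<and> E d a \<and> E e a \<and> E e d \<and>
        \<not> E a c \<and> \<not> E b d \<and> \<not> E b e \<and> \<not> E c e) \<or>
     (E a b \<and> E a c \<and> E b c \<and> E c d \<and> E d e \<and>
        \<not> E a d \<and> \<not> E a e \<and> \<not> E b d \<and> \<not> E b e \<and> \<not> E c e)"

definition in_class :: "('v \<Rightarrow> 'v \<Rightarrow> bool) \<Rightarrow> 'v set \<Rightarrow> bool" where
  "in_class E V \<longleftrightarrow>
     (\<forall>a \<in> V. \<forall>b \<in> V. \<forall>c \<in> V. \<forall>d \<in> V. \<forall>e \<in> V. \<not> forbidden E a b c d e)"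

lemma in_classD:
  assumes "in_class E V" "a \<in> V" "b \<in> V" "c \<in> V" "d \<in> V" "e \<in> V"
  shows "\<not> forbidden E a b c d e"
  using assms unfolding in_class_def by blast

lemma in_class_subset: "in_class E V \<Longrightarrow> W \<subseteq> V \<Longrightarrow> in_class E W"
  unfolding in_class_def by blast

text \<open>The smallest instance is an induced \<open>2K2\<close>, each side a single edge. Larger,
  possibly disconnected sides are allowed so that the union can be maximized.\<close>

definition two_K2 :: "('v \<Rightarrow> 'v \<Rightarrow> bool) \<Rightarrow> 'v set \<Rightarrow> 'v set \<Rightarrow> bool" where
  "two_K2 E A B \<longleftrightarrow> A \<noteq> {} \<and> B \<noteq> {} \<and> (\<forall>a \<in> A. \<exists>a' \<in> A. E a a') \<and> (\<forall>b \<in> B. \<exists>b' \<in> B. E b b') \<and>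
     (\<forall>a \<in> A. \<forall>b \<in> B. \<not> E a b \<and> \<not> E b a)"

lemma two_K2_sym: "two_K2 E A B \<Longrightarrow> two_K2 E B A"
  unfolding two_K2_def by blast

text \<open>
  A vertex adjacent to one end of an edge in \<open>A\<close> and to some vertex of \<open>B\<close> is adjacent to
  both ends, since otherwise a \<open>P5\<close> or a co-banner appears. So its non-neighbors in \<open>A\<close> would
  split off, which contradicts maximality.
\<close>

lemma maximal_two_K2_complete:
  assumes "symp E" "irreflp E" "in_class E V" "A \<subseteq> V" "B \<subseteq> V" "two_K2 E A B" "c \<in> V" "c \<notin> A \<union> B"
    and max: "\<And>A' B'. A' \<union> B' = insert c (A \<union> B) \<Longrightarrow> \<not> two_K2 E A' B'"
    and a: "a \<in> A" "E c a" and b: "b \<in> B" "E c b"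
  shows "\<forall>x \<in> A. E c x"
proof (rule ccontr)
  have S: "E x y = E y x" for x y using assms(1) by (auto simp: symp_def)
  note K = assms(6)[unfolded two_K2_def]
  assume "\<not> (\<forall>x \<in> A. E c x)"
  define A' where "A' = {x \<in> A. \<not> E c x}"
  obtain b' where b': "b' \<in> B" "E b b'" using K b by blast
  have edge: "E c y" if xy: "x \<in> A" "y \<in> A" "E x y" "E c x" for x y
  proof (rule ccontr)
    assume n: "\<not> E c y"
    have no: "\<not> E y b" "\<not> E y b'" "\<not> E x b" "\<not> E x b'" using K xy b b' by auto
    have V: "x \<in> V" "y \<in> V" "b \<in> V" "b' \<in> V" using xy b b' assms(4,5) by auto
    show False
    \<comment> \<open>If \<open>c\<close> is adjacent to \<open>b'\<close>, the triangle
      \<open>b b' c\<close> with tail \<open>x y\<close> is a co-banner; otherwise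
      \<open>y x c b b'\<close> is an induced \<open>P5\<close>.\<close>
    proof (cases "E c b'")
      case True
      then show False
        using in_classD[OF assms(3) V(3,4) assms(7) V(1,2)] n no xy b b' S unfolding forbidden_def by blast
    next
      case False
      then show False
        using in_classD[OF assms(3) V(2,1) assms(7) V(3,4)] n no xy b b' S unfolding forbidden_def by blast
    qed
  qed
  have cross: "\<not> E x y \<and> \<not> E y x" if "x \<in> A'" "y \<in> A - A'" for x y
    using that edge[of y x] S unfolding A'_def by blast
  \<comment> \<open>No side gets an isolated vertex: those of \<open>A - A'\<close> have the
    neighbor \<open>c\<close>, \<open>c\<close> has \<open>b\<close>, and by \<open>cross\<close>
    those of \<open>A'\<close> keep their neighbors within \<open>A'\<close>.\<close>
  have "two_K2 E A' ((A - A') \<union> B \<union> {c})"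
    unfolding two_K2_def
  proof (intro conjI ballI)
    show "A' \<noteq> {}" using \<open>\<not> (\<forall>x \<in> A. E c x)\<close> by (auto simp: A'_def)
    show "(A - A') \<union> B \<union> {c} \<noteq> {}" by simp
    show "\<exists>y \<in> A'. E x y" if "x \<in> A'" for x
    proof -
      have "x \<in> A" using that by (simp add: A'_def)
      then obtain y where "y \<in> A" "E x y" using K by blast
      then show ?thesis using cross[OF that] by blast
    qed
    show "\<exists>y \<in> (A - A') \<union> B \<union> {c}. E x y" if x: "x \<in> (A - A') \<union> B \<union> {c}" for x
    proof -
      consider "x \<in> A - A'" | "x \<in> B" | "x = c" using x by blast
      then show ?thesis
      proof cases
        case 1
        then show ?thesis using S by (auto simp: A'_def)
      next
        case 2
        then show ?thesis using K by blast
      next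
        case 3
        then show ?thesis using b by blast
      qed
    qed
    fix x y assume x: "x \<in> A'" and y: "y \<in> (A - A') \<union> B \<union> {c}"
    have "x \<in> A" "\<not> E c x" using x by (auto simp: A'_def)
    then show "\<not> E x y" "\<not> E y x" using y cross[OF x, of y] K S by blast+
  qed
  moreover have "A' \<union> ((A - A') \<union> B \<union> {c}) = insert c (A \<union> B)" by (auto simp: A'_def)
  ultimately show False using max by blast
qed

text \<open>Used against maximality: a vertex with neighbors on one side only could be added to that
  side, so a vertex with any neighbor in a maximum pair has neighbors on both sides.\<close>

lemma two_K2_insert:
  assumes "symp E" "two_K2 E A B" "a \<in> A" "E c a" "\<forall>b \<in> B. \<not> E c b"
  shows "two_K2 E (insert c A) B"
proof -
  note K = assms(2)[unfolded two_K2_def]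
  have "\<forall>b \<in> B. \<not> E b c" using assms(1,5) by (blast dest: sympD)
  moreover have "\<exists>a' \<in> insert c A. E x a'" if "x \<in> insert c A" for x
    using that assms(3,4) K by auto
  ultimately show ?thesis using K assms(5) unfolding two_K2_def by simp
qed

text \<open>These are the three ways in which canonical colorings pass from smaller graphs to larger
  ones. The third asks for two vertices on each side; an isolated vertex falls under the first,
  since it has no neighbors.\<close>

definition decomposable :: "('v \<Rightarrow> 'v \<Rightarrow> bool) \<Rightarrow> 'v set \<Rightarrow> bool" where
  "decomposable E V \<longleftrightarrow>
     (\<exists>s \<in> V. \<exists>w \<in> V. s \<noteq> w \<and> (\<forall>u \<in> V. E w u \<longrightarrow> E s u)) \<or>
     (\<exists>A B. V = A \<union> B \<and> A \<inter> B = {} \<and> A \<noteq> {} \<and> B \<noteq> {} \<and> (\<forall>a \<in> A. \<forall>b \<in> B. E a b)) \<or>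
     (\<exists>A B. V = A \<union> B \<and> A \<inter> B = {} \<and> 2 \<le> card A \<and> 2 \<le> card B \<and> (\<forall>a \<in> A. \<forall>b \<in> B. \<not> E a b))"

lemma decomposable_comparable:
  assumes "s \<in> V" "w \<in> V" "s \<noteq> w" "\<forall>u \<in> V. E w u \<longrightarrow> E s u"
  shows "decomposable E V"
  unfolding decomposable_def by (intro disjI1 bexI conjI) (rule assms)+

lemma decomposable_join:
  assumes "V = A \<union> B" "A \<inter> B = {}" "A \<noteq> {}" "B \<noteq> {}" "\<forall>a \<in> A. \<forall>b \<in> B. E a b"
  shows "decomposable E V"
  unfolding decomposable_def by (rule disjI2, rule disjI1, intro exI conjI) (rule assms)+

lemma decomposable_disjoint_union:
  assumes "V = A \<union> B" "A \<inter> B = {}" "2 \<le> card A" "2 \<le> card B" "\<forall>a \<in> A. \<forall>b \<in> B. \<not> E a b"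
  shows "decomposable E V"
  unfolding decomposable_def by (rule disjI2, rule disjI2, intro exI conjI) (rule assms)+

text \<open>A vertex anticomplete to a maximum pair yields comparable vertices. If there is none,
  the remaining vertices form a join with the union of the pair, or there are no others and the pair
  itself is a disjoint union.\<close>

lemma decomposable_two_K2:
  assumes "symp E" "irreflp E" "finite V" "in_class E V" "A0 \<subseteq> V" "B0 \<subseteq> V" "two_K2 E A0 B0"
  shows "decomposable E V"
proof -
  have S: "E x y = E y x" for x y using assms(1) by (auto simp: symp_def)
  have I: "\<not> E x x" for x using assms(2) by (simp add: irreflp_def)
  let ?P = "\<lambda>(A, B). A \<subseteq> V \<and> B \<subseteq> V \<and> two_K2 E A B"
  have "\<exists>p. ?P p \<and> (\<forall>q. ?P q \<longrightarrow> card (fst q \<union> snd q) \<le> card (fst p \<union> snd p))"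
    by (rule ex_has_greatest_nat[of ?P "(A0, B0)" "\<lambda>p. card (fst p \<union> snd p)" "Suc (card V)"])
      (use assms in \<open>auto simp: less_Suc_eq_le intro: card_mono\<close>)
  then obtain A B where AB: "A \<subseteq> V" "B \<subseteq> V" "two_K2 E A B"
    and max: "\<And>A' B'. A' \<subseteq> V \<Longrightarrow> B' \<subseteq> V \<Longrightarrow> two_K2 E A' B' \<Longrightarrow> card (A' \<union> B') \<le> card (A \<union> B)"
    by auto
  note K = AB(3)[unfolded two_K2_def]
  let ?S = "A \<union> B"
  have fin: "finite ?S" using AB assms(3) finite_subset by blast
  \<comment> \<open>\<open>C\<close> is a single vertex in the proof of \<open>mod\<close>, and
    later an edge to be added to \<open>B\<close>.\<close>
  have grow: "\<not> two_K2 E A' B'" if "C \<subseteq> V" "A' \<union> B' = C \<union> ?S" "\<not> C \<subseteq> ?S" for A' B' C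
  proof
    assume "two_K2 E A' B'"
    then have "card (C \<union> ?S) \<le> card ?S" using max[of A' B'] that AB by auto
    moreover have "finite (C \<union> ?S)" using that(1) AB assms(3) by (meson finite_subset Un_least)
    ultimately have "?S = C \<union> ?S" by (intro card_seteq) auto
    then show False using that(3) by blast
  qed
  have mod: "(\<forall>x \<in> ?S. E c x) \<or> (\<forall>x \<in> ?S. \<not> E c x)" if c: "c \<in> V" "c \<notin> ?S" for c
  proof (cases "\<exists>x \<in> ?S. E c x")
    case True
    have maxc: "\<not> two_K2 E A' B'" if "A' \<union> B' = insert c ?S" for A' B'
      using grow[of "{c}" A' B'] that c by auto
    have maxc': "\<not> two_K2 E A' B'" if "A' \<union> B' = insert c (B \<union> A)" for A' B'
      using maxc[of A' B'] that by (simp add: Un_commute)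
    have "\<exists>a \<in> A. E c a"
    proof (rule ccontr)
      assume n: "\<not> (\<exists>a \<in> A. E c a)"
      then obtain b where "b \<in> B" "E c b" using True by blast
      from two_K2_insert[OF assms(1) two_K2_sym[OF AB(3)] this] n maxc'[of "insert c B" A]
      show False by auto
    qed
    moreover have "\<exists>b \<in> B. E c b"
    proof (rule ccontr)
      assume n: "\<not> (\<exists>b \<in> B. E c b)"
      then obtain a where "a \<in> A" "E c a" using True by blast
      from two_K2_insert[OF assms(1) AB(3) this] n maxc[of "insert c A" B]
      show False by auto
    qed
    ultimately obtain a b where ab: "a \<in> A" "E c a" "b \<in> B" "E c b" by blast
    have "\<forall>x \<in> A. E c x"
      by (rule maximal_two_K2_complete[OF assms(1,2,4) AB c maxc ab])
    moreover have "\<forall>x \<in> B. E c x"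
      by (rule maximal_two_K2_complete[OF assms(1,2,4) AB(2,1) two_K2_sym[OF AB(3)] c(1) _ maxc' ab(3,4,1,2)])
        (use c(2) in auto)
    ultimately show ?thesis by blast
  qed blast
  define N where "N = {c \<in> V - ?S. \<forall>x \<in> ?S. E c x}"
  obtain a where a: "a \<in> A" using K by blast
  show ?thesis
  proof (cases "\<exists>i \<in> V - ?S. \<forall>x \<in> ?S. \<not> E i x")
    case True
    then obtain i where i: "i \<in> V" "i \<notin> ?S" "\<forall>x \<in> ?S. \<not> E i x" by blast
    \<comment> \<open>A neighbor \<open>u\<close> of \<open>i\<close> that misses \<open>a\<close>
      is anticomplete to the pair by \<open>mod\<close>, and then the edge \<open>i u\<close> could
      be added to \<open>B\<close>.\<close>
    have "E a u" if u: "u \<in> V" "E i u" for u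
    proof (rule ccontr)
      assume n: "\<not> E a u"
      have uS: "u \<notin> ?S" using i u by blast
      then have iso: "\<forall>x \<in> ?S. \<not> E u x" using mod[OF u(1)] n S a by blast
      have "two_K2 E A (B \<union> {i, u})"
        using K i iso u S unfolding two_K2_def by (auto; blast)
      then show False using grow[of "{i, u}" A "B \<union> {i, u}"] i u by auto
    qed
    moreover have "a \<in> V" "a \<noteq> i" using a AB(1) i(2) by auto
    ultimately show ?thesis using decomposable_comparable[OF _ i(1)] by blast
  next
    case False
    then have V: "V = ?S \<union> N" using mod AB unfolding N_def by blast
    show ?thesis
    proof (cases "N = {}")
      case True
      have two: "2 \<le> card T" if T: "\<forall>x \<in> T. \<exists>y \<in> T. E x y" "T \<noteq> {}" "T \<subseteq> ?S" for T
      proof -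
        obtain x y where xy: "x \<in> T" "y \<in> T" "E x y" using T by blast
        then have "x \<noteq> y" using I by blast
        then have "card {x, y} = 2" by simp
        moreover have "card {x, y} \<le> card T"
          using xy T(3) fin by (intro card_mono finite_subset[OF T(3)]) auto
        ultimately show ?thesis by simp
      qed
      have "A \<inter> B = {}" using K by blast
      moreover have "2 \<le> card A" "2 \<le> card B" using two[of A] two[of B] K by auto
      ultimately show ?thesis using V True K by (intro decomposable_disjoint_union[of V A B]) auto
    next
      case False
      have "?S \<inter> N = {}" "\<forall>x \<in> ?S. \<forall>y \<in> N. E x y" using S by (auto simp: N_def)
      then show ?thesis using V False a by (intro decomposable_join[of V ?S N]) auto
    qed
  qed
qed

text \<open>
  In the complement: two adjacent, incomparable vertices extend to an induced \<open>P4\<close>, whose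
  first two vertices are comparable because the complement contains no \<open>C4\<close>, \<open>C5\<close> or \<open>P5\<close>.
\<close>

lemma decomposable_2K2_free:
  assumes "symp E" "2 \<le> card V" "in_class E V"
    and free: "\<And>A B. A \<subseteq> V \<Longrightarrow> B \<subseteq> V \<Longrightarrow> \<not> two_K2 E A B"
  shows "decomposable E V"
proof (rule ccontr)
  assume nd: "\<not> decomposable E V"
  have S: "E x y = E y x" for x y using assms(1) by (auto simp: symp_def)
  have ncomp: "\<exists>u \<in> V. E w u \<and> \<not> E s u" if "s \<in> V" "w \<in> V" "s \<noteq> w" for s w
    using nd decomposable_comparable[of s V w E] that by metis
  have K2: "E a c \<or> E a d \<or> E b c \<or> E b d" if "a \<in> V" "b \<in> V" "c \<in> V" "d \<in> V" "E a b" "E c d" for a b c d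
    using free[of "{a, b}" "{c, d}"] that S unfolding two_K2_def by blast
  have fin: "finite V" using assms(2) card.infinite by fastforce
  \<comment> \<open>A complete graph is the join of one vertex with the rest.\<close>
  have "\<exists>s \<in> V. \<exists>w \<in> V. s \<noteq> w \<and> \<not> E s w"
  proof (rule ccontr)
    assume c: "\<not> (\<exists>s \<in> V. \<exists>w \<in> V. s \<noteq> w \<and> \<not> E s w)"
    obtain v where v: "v \<in> V" using assms(2) by fastforce
    have "V - {v} \<noteq> {}"
      using assms(2) v fin by (metis Diff_empty One_nat_def Suc_1 card.empty card_Suc_Diff1 finite_Diff not_less_eq_eq le0)
    then have "decomposable E V"
      by (intro decomposable_join[of V "{v}" "V - {v}"]) (use v c in auto)
    then show False using nd by blast
  qed
  then obtain s w where sw: "s \<in> V" "w \<in> V" "s \<noteq> w" "\<not> E s w" by blast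
  obtain s' where s': "s' \<in> V" "E w s'" "\<not> E s s'" using ncomp sw by blast
  obtain w' where w': "w' \<in> V" "E s w'" "\<not> E w w'" using ncomp[of w s] sw by blast
  \<comment> \<open>Otherwise the edges \<open>w s'\<close> and \<open>s w'\<close> form a
    \<open>2K2\<close>; so \<open>s w' s' w\<close> is an induced \<open>P4\<close>.\<close>
  have ws: "E s' w'" using K2[of w s' s w'] sw s' w' S by blast
  have "s' \<noteq> s" using s' sw S by blast
  then obtain t where t: "t \<in> V" "E s t" "\<not> E s' t" using ncomp[of s' s] sw s' by blast
  show False
  \<comment> \<open>If \<open>w\<close> and \<open>t\<close> are nonadjacent, the edges
    \<open>w s'\<close> and \<open>s t\<close> form a \<open>2K2\<close>. Otherwise there is a house
    with square \<open>w' s' w t\<close> and roof \<open>s\<close>, or the \<open>C5\<close> on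
    \<open>s w' s' w t\<close>, according to whether \<open>w'\<close> and \<open>t\<close> are
    adjacent.\<close>
  proof (cases "E w t")
    case False
    then show False using K2[of w s' s t] sw s' t S by blast
  next
    case wt: True
    show False
    proof (cases "E w' t")
      case True
      then show False
        using in_classD[OF assms(3) w'(1) s'(1) sw(2) t(1) sw(1)] sw s' w' t ws wt S unfolding forbidden_def by blast
    next
      case False
      then show False
        using in_classD[OF assms(3) sw(1) w'(1) s'(1) sw(2) t(1)] sw s' w' t ws wt S unfolding forbidden_def by blast
    qed
  qed
qed

lemma decomposable_in_class:
  assumes "symp E" "irreflp E" "in_class E V" "2 \<le> card V"
  shows "decomposable E V"
proof -
  have "finite V" using assms(4) card.infinite by fastforce
  then show ?thesis
    using decomposable_two_K2[OF assms(1,2) _ assms(3)] decomposable_2K2_free[OF assms(1,4,3)] by blast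
qed

section \<open>Canonical colorings for the class, and recoloring between arbitrary colorings\<close>

lemma canonical_exists:
  assumes "symp E" "irreflp E" "finite V" "in_class E V"
  shows "\<exists>\<kappa> k. canonical E V \<kappa> k"
  using assms(3,4)
proof (induction V rule: finite_psubset_induct)
  case (psubset V)
  have sub: "\<exists>\<kappa> k. canonical E W \<kappa> k" if "W \<subset> V" for W
    using psubset.IH[OF that] in_class_subset[OF psubset.prems] that by blast
  show ?case
  proof (cases "2 \<le> card V")
    case False
    then have "card V = 0 \<or> card V = 1" by linarith
    then consider "V = {}" | w where "V = {w}"
      using psubset.hyps by (auto simp: card_1_singleton_iff)
    then show ?thesis
    proof cases
      case 1
      then show ?thesis using canonical_empty by metis
    next
      case 2
      then show ?thesis using canonical_singleton[OF assms(2)] by metis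
    qed
  next
    case True
    from decomposable_in_class[OF assms(1,2) psubset.prems True, unfolded decomposable_def]
    show ?thesis
    proof (elim disjE bexE exE conjE)
      fix s w assume sw: "s \<in> V" "w \<in> V" "s \<noteq> w" "\<forall>u \<in> V. E w u \<longrightarrow> E s u"
      then obtain \<kappa> k where "canonical E (V - {w}) \<kappa> k" using sub[of "V - {w}"] by blast
      from canonical_comparable[OF assms(1,2) psubset.hyps(1) sw this]
      show ?thesis by (intro exI)
    next
      fix A B assume AB: "V = A \<union> B" "A \<inter> B = {}" "A \<noteq> {}" "B \<noteq> {}" "\<forall>a \<in> A. \<forall>b \<in> B. E a b"
      then have "A \<subset> V" "B \<subset> V" by auto
      then obtain \<kappa>1 k1 \<kappa>2 k2 where can: "canonical E A \<kappa>1 k1" "canonical E B \<kappa>2 k2" using sub by metis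
      have "finite A" "finite B" using psubset.hyps(1) AB(1) by auto
      from canonical_join[OF assms(1) this AB(2,5) can] show ?thesis
        unfolding AB(1) by (intro exI)
    next
      fix A B assume AB: "V = A \<union> B" "A \<inter> B = {}" "2 \<le> card A" "2 \<le> card B"
        "\<forall>a \<in> A. \<forall>b \<in> B. \<not> E a b"
      have ne: "A \<noteq> {}" "B \<noteq> {}" using AB(3,4) by auto
      then have "A \<subset> V" "B \<subset> V" using AB by auto
      then obtain \<kappa>1 k1 \<kappa>2 k2 where can: "canonical E A \<kappa>1 k1" "canonical E B \<kappa>2 k2" using sub by metis
      have fin: "finite A" "finite B" using psubset.hyps(1) AB(1) by auto
      show ?thesis
      \<comment> \<open>The side with more classes supplies the colors, and the other side needs its
        two vertices as slack; since either side may be the larger, both sizes matter.\<close>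
      proof (cases "k2 \<le> k1")
        case True
        have "canonical E (A \<union> B) (override_on \<kappa>2 \<kappa>1 A) k1"
          by (rule canonical_disjoint_union[OF assms(1) fin AB(2,3) ne(2) _ can True]) (use AB(5) in blast)
        then show ?thesis unfolding AB(1) by (intro exI)
      next
        case False
        then have le: "k1 \<le> k2" by simp
        have "B \<inter> A = {}" using AB(2) by blast
        then have "canonical E (B \<union> A) (override_on \<kappa>1 \<kappa>2 B) k2"
          by (rule canonical_disjoint_union[OF assms(1) fin(2,1) _ AB(4) ne(1) _ can(2,1) le])
            (use AB(5) assms(1) in \<open>blast dest: sympD\<close>)
        then show ?thesis unfolding AB(1) Un_commute[of A B] by (intro exI)
      qed
    qed
  qed
qed

text \<open>Both colorings are brought to the classes of \<open>\<kappa>\<close>, the second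
  sequence is reversed, and a permutation of the colors links the two. The ends meet outside
  \<open>V\<close> because \<open>c\<close> and \<open>d\<close> agree there.\<close>

lemma recol_canonical:
  assumes can: "canonical E V \<kappa> k" and "finite V" "k < card X"
    and c: "proper E V X c" and d: "proper E V X d" and out: "\<And>v. v \<notin> V \<Longrightarrow> c v = d v"
  shows "\<exists>m. recol E V X c m d \<and> (\<forall>v \<in> V. m v \<le> 2 * card V)"
proof -
  obtain i m1 where i: "inj_on i {..<k}" "i ` {..<k} \<subseteq> X"
    and m1: "recol E V X c m1 (override_on c (i \<circ> \<kappa>) V)" "\<forall>v \<in> V. m1 v < card V"
    using canonicalD(3)[OF can assms(3) c] by blast
  obtain j m2 where j: "inj_on j {..<k}" "j ` {..<k} \<subseteq> X"
    and m2: "recol E V X d m2 (override_on d (j \<circ> \<kappa>) V)" "\<forall>v \<in> V. m2 v < card V"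
    using canonicalD(3)[OF can assms(3) d] by blast
  obtain m3 where m3: "recol E V X (override_on c (i \<circ> \<kappa>) V) m3 (override_on c (j \<circ> \<kappa>) V)"
    "\<forall>v \<in> V. m3 v \<le> 2"
    using recol_permute[OF canonicalD(1)[OF can] assms(2,3) i j] by blast
  have "override_on c (j \<circ> \<kappa>) V = override_on d (j \<circ> \<kappa>) V"
    using out by (auto simp: override_on_def)
  then have "recol E V X (override_on c (j \<circ> \<kappa>) V) m2 d"
    using recol_sym[OF m2(1)] by simp
  from recol_trans[OF recol_trans[OF this m3(1)] m1(1)]
  have "recol E V X c (\<lambda>v. m1 v + (m3 v + m2 v)) d" .
  moreover have "\<forall>v \<in> V. m1 v + (m3 v + m2 v) \<le> 2 * card V"
    using m1(2) m2(2) m3(2) by fastforce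
  ultimately show ?thesis by blast
qed

section \<open>Graphs as \<open>pair_pre_digraph\<close>s\<close>

abbreviation adj :: "'a pair_pre_digraph \<Rightarrow> 'a \<Rightarrow> 'a \<Rightarrow> bool" where
  "adj G u v \<equiv> (u, v) \<in> parcs G"

lemma pair_graph_adj:
  assumes "pair_graph G"
  shows "symp (adj G)" "irreflp (adj G)" "finite (pverts G)"
proof -
  interpret pair_graph G by fact
  show "symp (adj G)" using pair_sym_arcs by (auto simp: symmetric_def sym_def symp_def)
  show "irreflp (adj G)" using no_loops' by (auto simp: irreflp_def)
  show "finite (pverts G)" by (rule pair_finite_verts)
qed

lemma in_class_adj:
  assumes G: "pair_graph G" and free: "induced_free {P5, C5, house, co_banner} G"
  shows "in_class (adj G) (pverts G)"
proof (rule ccontr)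
  assume "\<not> in_class (adj G) (pverts G)"
  then obtain a b c d e where V: "a \<in> pverts G" "b \<in> pverts G" "c \<in> pverts G" "d \<in> pverts G" "e \<in> pverts G"
    and F: "forbidden (adj G) a b c d e"
    unfolding in_class_def by blast
  have S: "adj G x y = adj G y x" for x y using pair_graph_adj(1)[OF G] by (auto simp: symp_def)
  have I: "\<not> adj G x x" for x using pair_graph_adj(2)[OF G] by (auto simp: irreflp_def)
  have five: "{..<5::nat} = {0, 1, 2, 3, 4}" by auto
  have "\<forall>H \<in> {P5, C5, house, co_banner}. pair_graph H"
    using pair_graph_P5 pair_graph_C5 pair_graph_house pair_graph_co_banner by blast
  then have none: "\<not> (\<exists>f. inj_on f (pverts H) \<and> f ` pverts H \<subseteq> pverts G \<and>
      (\<forall>u \<in> pverts H. \<forall>v \<in> pverts H. adj G (f u) (f v) \<longleftrightarrow> adj H u v))"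
    if "H \<in> {P5, C5, house, co_banner}" for H
    using that free induced_free_iff_no_embedding[OF G, of "{P5, C5, house, co_banner}"] by blast
  \<comment> \<open>Indexing into the list \<open>[p, q, r, s, t]\<close> is the embedding of the
    vertices 0 to 4.\<close>
  have no: False
    if "H \<in> {P5, C5, house, co_banner}" "H = edge_graph 5 R" "distinct [p, q, r, s, t]"
      "{p, q, r, s, t} \<subseteq> pverts G"
      "\<forall>u \<in> {0, 1, 2, 3, 4}. \<forall>v \<in> {0, 1, 2, 3, 4}.
        adj G ([p, q, r, s, t] ! u) ([p, q, r, s, t] ! v) \<longleftrightarrow> (u, v) \<in> R \<or> (v, u) \<in> R"
    for H R p q r s t
  proof -
    have "inj_on ((!) [p, q, r, s, t]) {..<5}"
      using that(3) by (intro inj_on_nth) auto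
    moreover have "(!) [p, q, r, s, t] ` {..<5} \<subseteq> pverts G"
      using that(4) unfolding five by simp
    ultimately show False
      using none[OF that(1)] that(5) unfolding that(2) edge_graph_def five
      by (simp only: pair_pre_digraph.simps Un_iff converse_iff) blast
  qed
  from F[unfolded forbidden_def] show False
  proof (elim disjE)
    assume *: "adj G a b \<and> adj G b c \<and> adj G c d \<and> adj G d e \<and>
      \<not> adj G a c \<and> \<not> adj G a d \<and> \<not> adj G a e \<and> \<not> adj G b d \<and> \<not> adj G b e \<and> \<not> adj G c e"
    then have "distinct [a, b, c, d, e]" using S I by auto
    from no[OF _ P5_def this] show False using * V S I by simp
  next
    assume *: "adj G a b \<and> adj G b c \<and> adj G c d \<and> adj G d e \<and> adj G e a \<and>
      \<not> adj G a c \<and> \<not> adj G a d \<and> \<not> adj G b d \<and> \<not> adj G b e \<and> \<not> adj G c e"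
    then have "distinct [a, b, c, d, e]" using S I by auto
    from no[OF _ C5_def this] show False using * V S I by simp
  next
    assume *: "adj G a b \<and> adj G b c \<and> adj G c d \<and> adj G d a \<and> adj G e a \<and> adj G e d \<and>
      \<not> adj G a c \<and> \<not> adj G b d \<and> \<not> adj G b e \<and> \<not> adj G c e"
    \<comment> \<open>The numbered house has the square 0, 3, 1, 4 and the roof 2, hence this
      order.\<close>
    then have "distinct [a, c, e, b, d]" using S I by auto
    from no[OF _ house_eq_edge_graph this] show False using * V S I by simp
  next
    assume *: "adj G a b \<and> adj G a c \<and> adj G b c \<and> adj G c d \<and> adj G d e \<and>
      \<not> adj G a d \<and> \<not> adj G a e \<and> \<not> adj G b d \<and> \<not> adj G b e \<and> \<not> adj G c e"
    then have "distinct [a, b, c, d, e]" using S I by auto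
    from no[OF _ co_banner_def this] show False using * V S I by simp
  qed
qed

section \<open>Recoloring sequences as walks in the recoloring graph\<close>

lemma colorings_iff_proper:
  "c \<in> colorings G l \<longleftrightarrow> proper (adj G) (pverts G) {1..l} c \<and> c \<in> extensional (pverts G)"
  if "pair_graph G"
proof -
  interpret pair_graph G by fact
  show ?thesis
    using in_arcsD1 in_arcsD2
    by (auto simp: colorings_def proper_def PiE_def Pi_def image_subset_iff)
qed

text \<open>A step that changes a color is an arc; an idle step adds to the counts but not to the
  walk, hence only an inequality.\<close>

lemma recol_awalk:
  assumes G: "pair_graph G" and c: "c \<in> colorings G l"
    and "recol (adj G) (pverts G) {1..l} c m d"
  shows "d \<in> colorings G l \<and>
    (\<exists>p. pre_digraph.awalk (with_proj (recoloring_graph G l)) c p d \<and> length p \<le> sum m (pverts G))"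
  using assms(3)
proof (induction rule: recol.induct)
  interpret R: pair_graph "recoloring_graph G l" by (rule pair_graph_recoloring_graph[OF G])
  case refl
  have "c \<in> pverts (recoloring_graph G l)" using c by (simp add: recoloring_graph_def)
  then have "R.awalk c [] c" by (simp add: R.awalk_Nil_iff)
  then show ?case using c by force
next
  interpret R: pair_graph "recoloring_graph G l" by (rule pair_graph_recoloring_graph[OF G])
  case (step m d v x)
  let ?d = "d(v := x)"
  have fin: "finite (pverts G)" by (rule pair_graph_adj(3)[OF G])
  have d: "d \<in> colorings G l" using step.IH by blast
  obtain p where p: "R.awalk c p d" "length p \<le> sum m (pverts G)" using step.IH by blast
  have d': "?d \<in> colorings G l"
    using d step.hyps(2,3) by (auto simp: colorings_iff_proper[OF G] extensional_def)
  have "sum (m(v := Suc (m v))) (pverts G) = Suc (m v) + sum m (pverts G - {v})"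
    using fin step.hyps(2) by (simp add: sum.remove)
  then have sum: "sum (m(v := Suc (m v))) (pverts G) = Suc (sum m (pverts G))"
    using fin step.hyps(2) by (simp add: sum.remove)
  have "\<exists>p. R.awalk c p ?d \<and> length p \<le> Suc (sum m (pverts G))"
  proof (cases "x = d v")
    case True
    then show ?thesis using p by auto
  next
    case False
    then have "(d, ?d) \<in> parcs (recoloring_graph G l)"
      using d d' step.hyps(2) by (auto simp: recoloring_graph_def)
    then have "R.awalk d [(d, ?d)] ?d" using R.arc_implies_awalk[of "(d, ?d)"] by simp
    then have "R.awalk c (p @ [(d, ?d)]) ?d" using p(1) by simp
    then show ?thesis using p(2) by (intro exI[of _ "p @ [(d, ?d)]"]) simp
  qed
  then show ?case using d' unfolding sum by blast
qed

theorem theorem15: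
  fixes G :: "'a pair_pre_digraph" and n :: nat
  assumes "pair_graph G"
    and "n = card (pverts G)"
    and "induced_free {P5, C5, house, co_banner} G"
  shows "recolorable G \<and>
    (\<forall>l \<ge> chromatic_number G + 1. diameter (recoloring_graph G l) \<le> ereal (real (2 * n\<^sup>2)))"
proof -
  note G = assms(1) and adj = pair_graph_adj[OF assms(1)]
  obtain \<kappa> k where can: "canonical (adj G) (pverts G) \<kappa> k"
    using canonical_exists[OF adj in_class_adj[OF G assms(3)]] by blast
  have nonempty: "colorings G l \<noteq> {}" if "k \<le> l" for l
  proof -
    \<comment> \<open>Classes are numbered from 0 but colors from 1, and \<open>colorings\<close>
      demands extensional functions.\<close>
    have "restrict (Suc \<circ> \<kappa>) (pverts G) \<in> colorings G l"
      using canonicalD(1)[OF can] that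
      by (fastforce simp: colorings_iff_proper[OF G] proper_def)
    then show ?thesis by blast
  qed
  have "colorings G (chromatic_number G) \<noteq> {}"
    unfolding chromatic_number_def by (rule LeastI) (rule nonempty[OF order_refl])
  then obtain c0 where "c0 \<in> colorings G (chromatic_number G)" by blast
  \<comment> \<open>The lower bound in \<open>canonical\<close> applies to \<open>c0\<close>; every
    \<open>l\<close> above the chromatic number thus has a spare color.\<close>
  then have k: "k \<le> chromatic_number G"
    using canonicalD(2)[OF can, of "{1..chromatic_number G}" c0] by (simp add: colorings_iff_proper[OF G])
  have walk: "\<exists>p. pre_digraph.awalk (with_proj (recoloring_graph G l)) c p d \<and> length p \<le> 2 * n\<^sup>2"
    if l: "chromatic_number G + 1 \<le> l" and cd: "c \<in> colorings G l" "d \<in> colorings G l" for l c d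
  proof -
    have "k < card {1..l}" using k l by simp
    moreover have "c v = d v" if "v \<notin> pverts G" for v
      using cd that by (simp add: colorings_iff_proper[OF G] extensional_def)
    ultimately obtain m where m: "recol (adj G) (pverts G) {1..l} c m d"
      "\<forall>v \<in> pverts G. m v \<le> 2 * card (pverts G)"
      using recol_canonical[OF can adj(3)] cd colorings_iff_proper[OF G] by metis
    \<comment> \<open>Each of the \<open>n\<close> vertices is recolored at most
      \<open>2 * n\<close> times.\<close>
    have "sum m (pverts G) \<le> 2 * n\<^sup>2"
      using sum_bounded_above[of "pverts G" m "2 * n"] m(2) assms(2) by (simp add: power2_eq_square)
    then show ?thesis using recol_awalk[OF G cd(1) m(1)] by fastforce
  qed
  have "Digraph_Component.connected (with_proj (recoloring_graph G l))" if l: "chromatic_number G + 1 \<le> l" for l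
  proof -
    interpret R: pair_graph "recoloring_graph G l" by (rule pair_graph_recoloring_graph[OF G])
    show ?thesis
      unfolding Digraph_Component.connected_def
    proof (rule strongly_connectedI)
      show "verts (with_proj (mk_symmetric (with_proj (recoloring_graph G l)))) \<noteq> {}"
        using nonempty[of l] k l by (simp add: recoloring_graph_def)
      fix c d
      assume "c \<in> verts (with_proj (mk_symmetric (with_proj (recoloring_graph G l))))"
        and "d \<in> verts (with_proj (mk_symmetric (with_proj (recoloring_graph G l))))"
      then obtain p where "R.awalk c p d"
        using walk[OF l, of c d] by (auto simp: recoloring_graph_def)
      then show "c \<rightarrow>\<^sup>*\<^bsub>with_proj (mk_symmetric (with_proj (recoloring_graph G l)))\<^esub> d"
        by (intro R.reachable_mk_symmetricI R.reachable_awalkI)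
    qed
  qed
  moreover have "diameter (recoloring_graph G l) \<le> ereal (real (2 * n\<^sup>2))" if l: "chromatic_number G + 1 \<le> l" for l
  proof -
    interpret R: pair_graph "recoloring_graph G l" by (rule pair_graph_recoloring_graph[OF G])
    have "R.\<mu> (\<lambda>_. 1) c d \<le> ereal (real (2 * n\<^sup>2))" if cd: "c \<in> colorings G l" "d \<in> colorings G l" for c d
    proof -
      obtain p where p: "R.awalk c p d" "length p \<le> 2 * n\<^sup>2" using walk[OF l cd] by blast
      have "R.awalk_cost (\<lambda>_. 1) p = real (length p)"
        by (simp add: R.awalk_cost_def sum_list_triv)
      then have "R.\<mu> (\<lambda>_. 1) c d \<le> ereal (real (length p))"
        using R.min_cost_le_walk_cost[OF p(1), of "\<lambda>_. 1"] by simp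
      also have "\<dots> \<le> ereal (real (2 * n\<^sup>2))"
        using p(2) by (simp only: ereal_less_eq of_nat_le_iff)
      finally show ?thesis .
    qed
    then show ?thesis
      unfolding diameter_def by (intro SUP_least) (simp add: recoloring_graph_def)
  qed
  ultimately show ?thesis unfolding recolorable_def by blast
qed

end
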